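(* Let $T$ be a left-invariant $(0,2)$ tensor field on $SL(2)$. There exist a left-invariant Riemannian metric $g$ and a constant $c>0$ such that $\mathrm{Ric}(g)=cT$ if and only if $T$ is diagonalisable with $T=\mathrm{diag}(T_1,T_2,T_3)$ in a basis $V_1,V_2,V_3$ of the Lie algebra satisfying $[V_i,V_j]=\sum_{k=1}^3\epsilon_{ijk}\lambda_kV_k$ with $\lambda_1=\lambda_2=2$, $\lambda_3=-2$, and one of the following conditions is satisfied: (i) $T_1>0$, $T_2,T_3<0$, $-T_1<T_3$; (ii) $T_2>0$, $T_1,T_3<0$, $-T_2<T_3$; (iii) $T_1,T_2<0$, $T_3>0$, $\max\{-T_1,-T_2\}<T_3$; (iv) $T_1,T_2<0$, $T_3>0$, $\min\{-T_1,-T_2\}>T_3$; (v) $T_1=T_2=-T_3<0$; (vi) $T_1<0$, $T_2=T_3=0$; (vii) $T_2<0$, $T_1=T_3=0$. In cases (i)-(iv), the solution $(g,c)$ of $\mathrm{Ric}(g)=cT$ is unique. In cases (v)-(vii), there are infinitely many solutions $(g,c)$, but $c$ is the same for all solutions.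
   Context: $SL(2)$ denotes the three-dimensional unimodular Lie group whose Lie algebra ($\mathfrak{sl}(2,\mathbb R)$) has a basis with $[V_i,V_j]=\sum_k\epsilon_{ijk}\lambda_kV_k$, $(\lambda_1,\lambda_2,\lambda_3)=(2,2,-2)$, where $\epsilon_{ijk}$ is the Levi-Civita symbol. Left-invariant tensor fields are identified with tensors on the Lie algebra. $\mathrm{Ric}(g)$ is the Ricci curvature $(0,2)$-tensor of $g$. $T=\mathrm{diag}(T_1,T_2,T_3)$ in the basis $V_1,V_2,V_3$ means $T(V_i,V_i)=T_i$ and $T(V_i,V_j)=0$ for $i\neq j$. If $(g,c)$ is a solution of $\mathrm{Ric}(g)=cT$, then so is $(c'g,c)$ for every $c'>0$; uniqueness and the number of solutions $(g,c)$ are always understood up to scaling of $g$ (so "unique" means that any other solution $(\bar g,\bar c)$ has $\bar c=c$ and $\bar g$ a positive multiple of $g$). *)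

theory Defs
  imports "HOL-Analysis.Analysis"
begin

definition levi_civita_symbol :: "3 \<Rightarrow> 3 \<Rightarrow> 3 \<Rightarrow> real" where
  "levi_civita_symbol i j k =
     (if (i, j, k) \<in> {(1, 2, 3), (2, 3, 1), (3, 1, 2)} then 1
      else if (i, j, k) \<in> {(1, 3, 2), (3, 2, 1), (2, 1, 3)} then -1
      else 0)"

definition sl2_const :: "3 \<Rightarrow> real" where
  "sl2_const k = (if k = 3 then -2 else 2)"

text \<open>The Lie algebra of SL(2) is modelled on \<open>real ^ 3\<close>; the bracket is the bilinear map whose
  structure constants in the standard basis are \<open>levi_civita_symbol i j k * sl2_const k\<close>.
  The inner product of \<open>real ^ 3\<close> plays no role below.\<close>

definition sl2_bracket :: "real ^ 3 \<Rightarrow> real ^ 3 \<Rightarrow> real ^ 3" where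
  "sl2_bracket x y =
     (\<chi> k. \<Sum>i\<in>UNIV. \<Sum>j\<in>UNIV. levi_civita_symbol i j k * sl2_const k * x $ i * y $ j)"

definition sl2_basis :: "(3 \<Rightarrow> real ^ 3) \<Rightarrow> bool" where
  "sl2_basis V \<longleftrightarrow>
     inj V \<and> independent (range V) \<and> span (range V) = UNIV \<and>
     (\<forall>i j. sl2_bracket (V i) (V j) =
        (\<Sum>k\<in>UNIV. (levi_civita_symbol i j k * sl2_const k) *\<^sub>R V k))"

lemma sl2_basis_axis: "sl2_basis (\<lambda>i. axis i 1)"
proof -
  have r: "range (\<lambda>i. axis i 1 :: real ^ 3) = Basis"
    by (auto simp: Basis_vec_def)
  have "sl2_bracket (axis i 1) (axis j 1) =
      (\<Sum>k\<in>UNIV. (levi_civita_symbol i j k * sl2_const k) *\<^sub>R axis k 1)" for i j :: 3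
    using exhaust_3[of i] exhaust_3[of j]
    by (auto simp: vec_eq_iff sl2_bracket_def axis_def sum_3 levi_civita_symbol_def)
  then show ?thesis
    unfolding sl2_basis_def r
    by (auto simp: independent_Basis span_Basis inj_on_def axis_eq_axis)
qed

text \<open>Left-invariant tensor fields are identified with their values on the Lie algebra. On
  left-invariant fields the functions \<open>g(Y,Z)\<close> are constant, so their derivatives vanish and
  compatibility of the Levi-Civita connection \<open>D\<close> with \<open>g\<close> reads \<open>g(D\<^sub>XY,Z) + g(Y,D\<^sub>XZ) = 0\<close>.\<close>

definition left_invariant_metric :: "(real ^ 3 \<Rightarrow> real ^ 3 \<Rightarrow> real) \<Rightarrow> bool" where
  "left_invariant_metric g \<longleftrightarrow>
     bilinear g \<and> (\<forall>x y. g x y = g y x) \<and> (\<forall>x. x \<noteq> 0 \<longrightarrow> g x x > 0)"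

definition levi_civita_connection ::
  "(real ^ 3 \<Rightarrow> real ^ 3 \<Rightarrow> real) \<Rightarrow> real ^ 3 \<Rightarrow> real ^ 3 \<Rightarrow> real ^ 3" where
  "levi_civita_connection g =
     (THE D. bilinear D \<and>
        (\<forall>x y. D x y - D y x = sl2_bracket x y) \<and>
        (\<forall>x y z. g (D x y) z + g y (D x z) = 0))"

definition riemann_curvature ::
  "(real ^ 3 \<Rightarrow> real ^ 3 \<Rightarrow> real) \<Rightarrow> real ^ 3 \<Rightarrow> real ^ 3 \<Rightarrow> real ^ 3 \<Rightarrow> real ^ 3" where
  "riemann_curvature g x y z =
     (let D = levi_civita_connection g
      in D x (D y z) - D y (D x z) - D (sl2_bracket x y) z)"

definition Ric :: "(real ^ 3 \<Rightarrow> real ^ 3 \<Rightarrow> real) \<Rightarrow> real ^ 3 \<Rightarrow> real ^ 3 \<Rightarrow> real" where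
  "Ric g y z = trace (matrix (\<lambda>x. riemann_curvature g x y z))"

definition ricci_solutions ::
  "(real ^ 3 \<Rightarrow> real ^ 3 \<Rightarrow> real) \<Rightarrow> ((real ^ 3 \<Rightarrow> real ^ 3 \<Rightarrow> real) \<times> real) set" where
  "ricci_solutions T =
     {(g, c). left_invariant_metric g \<and> c > 0 \<and> (\<forall>x y. Ric g x y = c * T x y)}"

definition scaling_rel ::
  "((real ^ 3 \<Rightarrow> real ^ 3 \<Rightarrow> real) \<times> real) rel" where
  "scaling_rel = {((g, c), (g', c')). c' = c \<and> (\<exists>a>0. g' = (\<lambda>x y. a * g x y))}"

definition diagonal_in ::
  "(real ^ 3 \<Rightarrow> real ^ 3 \<Rightarrow> real) \<Rightarrow> (3 \<Rightarrow> real ^ 3) \<Rightarrow> real \<Rightarrow> real \<Rightarrow> real \<Rightarrow> bool" where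
  "diagonal_in T V T1 T2 T3 \<longleftrightarrow>
     T (V 1) (V 1) = T1 \<and> T (V 2) (V 2) = T2 \<and> T (V 3) (V 3) = T3 \<and>
     (\<forall>i j. i \<noteq> j \<longrightarrow> T (V i) (V j) = 0)"

definition cases_i_to_iv :: "real \<Rightarrow> real \<Rightarrow> real \<Rightarrow> bool" where
  "cases_i_to_iv T1 T2 T3 \<longleftrightarrow>
     (T1 > 0 \<and> T2 < 0 \<and> T3 < 0 \<and> - T1 < T3) \<or>
     (T2 > 0 \<and> T1 < 0 \<and> T3 < 0 \<and> - T2 < T3) \<or>
     (T1 < 0 \<and> T2 < 0 \<and> T3 > 0 \<and> max (- T1) (- T2) < T3) \<or>
     (T1 < 0 \<and> T2 < 0 \<and> T3 > 0 \<and> min (- T1) (- T2) > T3)"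

definition cases_v_to_vii :: "real \<Rightarrow> real \<Rightarrow> real \<Rightarrow> bool" where
  "cases_v_to_vii T1 T2 T3 \<longleftrightarrow>
     (T1 = T2 \<and> T2 = - T3 \<and> - T3 < 0) \<or>
     (T1 < 0 \<and> T2 = 0 \<and> T3 = 0) \<or>
     (T2 < 0 \<and> T1 = 0 \<and> T3 = 0)"

end

theory Submission
  imports Defs
begin

text \<open>A basis with the brackets of the statement is the same thing as a matrix of the group
  \<open>SO(2,1)\<close> (\<open>sl2_basis_iff_lorentz_matrix\<close>): the bracket is the cross product followed by
  \<open>2 lorentz\<close>, so that preserving the bracket means preserving the Lorentz form, which is the
  Killing form up to a factor. Diagonalising an inner product \<open>g\<close> in such a basis is therefore
  the simultaneous diagonalisation of a positive definite form and the Lorentz form, which is always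
  possible (\<open>milnor_frame\<close>).

  In a basis where \<open>g = diag(a, b, d)\<close> the Ricci curvature is diagonal as well
  (\<open>Ric_diagonal_frame\<close>), with entries whose signs are governed by \<open>a - b - d\<close>,
  \<open>b - a - d\<close> and \<open>a + b - d\<close>. Inspecting the signs gives the seven cases
  (\<open>ricci_classification\<close>), hence their necessity.

  For a tensor \<open>T\<close> that is diagonal in a given basis, the equation for metrics that are diagonal in
  the same basis is an algebraic system for \<open>a, b, d, c\<close>. Dividing by \<open>a + b + d\<close> and eliminating
  \<open>c\<close> leaves two equations in \<open>u = (b + d - a) / (a + b + d)\<close> and
  \<open>v = (a + d - b) / (a + b + d)\<close>, and \<open>w = u + v\<close> is a root of a cubic polynomial. In cases
  (i)-(iv) the intermediate value theorem gives an admissible root, and it is the only one because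
  the derivative of the cubic has the same nonzero sign at all admissible roots
  (\<open>reduced_exists\<close>, \<open>reduced_unique\<close>).

  A solution is a priori diagonal only in some other basis, and \<open>T\<close> is diagonal in that basis too.
  The two bases differ by a matrix \<open>Q\<close> of the Lorentz group that intertwines the two diagonal
  forms of the operator \<open>lorentz T\<close> (\<open>frame_transition\<close>). A Lorentz matrix has nonzero
  \<open>(3,3)\<close> entry, so the timelike eigenvalue \<open>- T\<^sub>3\<close> is an invariant. In cases (i)-(iv) it differs from
  \<open>T\<^sub>1\<close> and \<open>T\<^sub>2\<close>, which forces \<open>Q\<close> to be block diagonal, and then the solution is diagonal in
  the given basis as well (\<open>solution_diagonal_in_frame\<close>). In cases (v)-(vii) the other two
  eigenvalues are controlled enough to fix \<open>c\<close>, while one of the relations \<open>d = a + b\<close>,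
  \<open>b = a + d\<close>, \<open>a = b + d\<close> on the metric is all that the equation requires, which leaves
  a one-parameter family up to scaling.\<close>

section \<open>Bases with the standard brackets and the Lorentz group\<close>

unbundle cross3_syntax

lemma sl2_bracket_components:
  "sl2_bracket x y $ 1 = 2 * (x $ 2 * y $ 3 - x $ 3 * y $ 2)"
  "sl2_bracket x y $ 2 = 2 * (x $ 3 * y $ 1 - x $ 1 * y $ 3)"
  "sl2_bracket x y $ 3 = - 2 * (x $ 1 * y $ 2 - x $ 2 * y $ 1)"
  by (simp_all add: sl2_bracket_def sum_3 levi_civita_symbol_def sl2_const_def)

text \<open>The structure constants are twice the diagonal entries of this matrix; as a quadratic form on the
  Lie algebra it is the Killing form divided by 8.\<close>

definition lorentz :: "real ^ 3 ^ 3" where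
  "lorentz = (\<chi> i j. if i = j then (if i = 3 then -1 else 1) else 0)"

lemma lorentz_nth [simp]:
  "lorentz $ 1 $ 1 = 1" "lorentz $ 1 $ 2 = 0" "lorentz $ 1 $ 3 = 0"
  "lorentz $ 2 $ 1 = 0" "lorentz $ 2 $ 2 = 1" "lorentz $ 2 $ 3 = 0"
  "lorentz $ 3 $ 1 = 0" "lorentz $ 3 $ 2 = 0" "lorentz $ 3 $ 3 = -1"
  by (simp_all add: lorentz_def)

lemma mat3_eq_iff:
  fixes A B :: "real ^ 3 ^ 3"
  shows "A = B \<longleftrightarrow> A$1$1 = B$1$1 \<and> A$1$2 = B$1$2 \<and> A$1$3 = B$1$3 \<and>
    A$2$1 = B$2$1 \<and> A$2$2 = B$2$2 \<and> A$2$3 = B$2$3 \<and>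
    A$3$1 = B$3$1 \<and> A$3$2 = B$3$2 \<and> A$3$3 = B$3$3"
  by (simp add: vec_eq_iff forall_3)

lemma lorentz_squared: "lorentz ** lorentz = mat 1"
  by (simp add: mat3_eq_iff matrix_matrix_mult_def sum_3 mat_def)

lemma det_lorentz: "det lorentz = -1"
  by (simp add: det_3)

lemma det_scaleR_lorentz: "det (k *\<^sub>R lorentz) = - (k ^ 3)"
  by (simp add: det_3 power3_eq_cube)

text \<open>This reduces questions on the bracket to the equivariance of the cross product under linear maps.\<close>

lemma sl2_bracket_cross: "sl2_bracket x y = 2 *\<^sub>R (lorentz *v (x \<times> y))"
  by (simp add: vec_eq_iff forall_3 sl2_bracket_components matrix_vector_mult_def sum_3 cross3_simps)

lemma bilinear_sl2_bracket: "bilinear sl2_bracket"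
  unfolding bilinear_def
  by (auto intro!: linearI simp: vec_eq_iff forall_3 sl2_bracket_components algebra_simps)

lemma bilinear_compose_linear:
  assumes "bilinear f" "linear h" "linear k"
  shows "bilinear (\<lambda>x y. k (f (h x) (h y)))"
  unfolding bilinear_def
  by (auto intro!: linearI simp: linear_add[OF assms(2)] linear_cmul[OF assms(2)]
      linear_add[OF assms(3)] linear_cmul[OF assms(3)] bilinear_ladd[OF assms(1)] bilinear_radd[OF assms(1)]
      bilinear_lmul[OF assms(1)] bilinear_rmul[OF assms(1)])

text \<open>The condition is membership in \<open>SO(2,1)\<close>, the automorphism group of the Lie algebra.\<close>

definition lorentz_matrix :: "real ^ 3 ^ 3 \<Rightarrow> bool" where
  "lorentz_matrix A \<longleftrightarrow> transpose A ** lorentz ** A = lorentz \<and> det A = 1"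

definition frame_matrix :: "(3 \<Rightarrow> real ^ 3) \<Rightarrow> real ^ 3 ^ 3" where
  "frame_matrix V = (\<chi> i j. V j $ i)"

lemma frame_matrix_axis [simp]: "frame_matrix V *v axis j 1 = V j"
  by (simp add: frame_matrix_def matrix_vector_mult_basis column_def)

lemma lorentz_matrix_gram: "lorentz_matrix A \<Longrightarrow> transpose A ** lorentz ** A = lorentz"
  by (simp add: lorentz_matrix_def)

text \<open>The inverse of a matrix that preserves the Lorentz form, in a form polynomial in the entries.\<close>

definition lorentz_inverse :: "real ^ 3 ^ 3 \<Rightarrow> real ^ 3 ^ 3" where
  "lorentz_inverse A = lorentz ** transpose A ** lorentz"

lemma lorentz_matrix_inverse:
  assumes "transpose A ** lorentz ** A = lorentz"
  shows "lorentz_inverse A ** A = mat 1" and "A ** lorentz_inverse A = mat 1"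
proof -
  show *: "lorentz_inverse A ** A = mat 1"
    using assms lorentz_squared unfolding lorentz_inverse_def
    by (metis matrix_mul_assoc)
  then show "A ** lorentz_inverse A = mat 1"
    using matrix_left_right_inverse by blast
qed

lemma lorentz_matrix_bracket:
  assumes "lorentz_matrix A"
  shows "sl2_bracket (A *v x) (A *v y) = A *v sl2_bracket x y"
proof -
  have "transpose A *v ((A *v x) \<times> (A *v y)) = x \<times> y"
    using cross_matrix_mult[of A x y] assms by (simp add: lorentz_matrix_def)
  then have "A *v (lorentz *v (x \<times> y)) =
      (A ** lorentz_inverse A) *v (lorentz *v ((A *v x) \<times> (A *v y)))"
    using lorentz_squared unfolding lorentz_inverse_def
    by (metis matrix_mul_assoc matrix_vector_mul_assoc matrix_vector_mul_lid)
  then show ?thesis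
    using lorentz_matrix_inverse[OF lorentz_matrix_gram[OF assms]]
    by (simp add: sl2_bracket_cross matrix_vector_mult_scaleR)
qed

lemma sl2_basis_bracket:
  assumes "sl2_basis V"
  shows "sl2_bracket (frame_matrix V *v x) (frame_matrix V *v y) = frame_matrix V *v sl2_bracket x y"
proof -
  have "(\<lambda>x y. sl2_bracket (frame_matrix V *v x) (frame_matrix V *v y)) =
      (\<lambda>x y. frame_matrix V *v sl2_bracket x y)"
  proof (rule bilinear_eq_stdbasis)
    show "bilinear (\<lambda>x y. sl2_bracket (frame_matrix V *v x) (frame_matrix V *v y))"
      using bilinear_compose_linear[OF bilinear_sl2_bracket matrix_vector_mul_linear linear_ident] .
    show "bilinear (\<lambda>x y. frame_matrix V *v sl2_bracket x y)"
      using bilinear_compose_linear[OF bilinear_sl2_bracket linear_ident matrix_vector_mul_linear] .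
    fix i j :: "real ^ 3" assume "i \<in> Basis" "j \<in> Basis"
    then obtain k l where kl: "i = axis k 1" "j = axis l 1"
      by (auto simp: Basis_vec_def)
    show "sl2_bracket (frame_matrix V *v i) (frame_matrix V *v j) = frame_matrix V *v sl2_bracket i j"
      using assms sl2_basis_axis unfolding sl2_basis_def kl
      by (simp add: matrix_vector_right_distrib sum_3 matrix_vector_mult_scaleR)
  qed
  then show ?thesis by metis
qed

text \<open>If \<open>A\<close> preserves the bracket, then \<open>A\<^sup>T (A x \<times> A y) = det A (x \<times> y)\<close> gives
  \<open>A\<^sup>T J A J z = det A z\<close> for all cross products \<open>z\<close>, hence for all vectors, where
  \<open>J = lorentz\<close>. Taking determinants in \<open>A\<^sup>T J A = det A J\<close> yields \<open>det A\<^sup>2 = det A\<^sup>3\<close>, so that the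
  factor is 1.\<close>

lemma sl2_basis_iff_lorentz_matrix: "sl2_basis V \<longleftrightarrow> lorentz_matrix (frame_matrix V)"
proof
  let ?A = "frame_matrix V"
  assume V: "sl2_basis V"
  have "surj (\<lambda>x. ?A *v x)"
  proof -
    have "V i \<in> range (\<lambda>x. ?A *v x)" for i
      by (metis frame_matrix_axis rangeI)
    then have "span (range V) \<subseteq> range (\<lambda>x. ?A *v x)"
      by (intro span_minimal) (auto intro!: linear_subspace_image)
    then show ?thesis using V unfolding sl2_basis_def by auto
  qed
  then have inv: "det ?A \<noteq> 0"
    by (metis invertible_det_nz invertible_right_inverse matrix_right_invertible_surjective)
  have *: "transpose ?A *v (lorentz *v (?A *v (lorentz *v (x \<times> y)))) = det ?A *\<^sub>R (x \<times> y)" for x y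
  proof -
    have "lorentz *v (lorentz *v ((?A *v x) \<times> (?A *v y))) = lorentz *v (?A *v (lorentz *v (x \<times> y)))"
      using sl2_basis_bracket[OF V, of x y]
      by (simp add: sl2_bracket_cross matrix_vector_mult_scaleR)
    then show ?thesis
      using cross_matrix_mult[of ?A x y] by (simp add: matrix_vector_mul_assoc lorentz_squared)
  qed
  have "transpose ?A *v (lorentz *v (?A *v (lorentz *v z))) = det ?A *\<^sub>R z" for z
  proof -
    have z: "z = (z$1) *\<^sub>R (axis 2 1 \<times> axis 3 1) + (z$2) *\<^sub>R (axis 3 1 \<times> axis 1 1) + (z$3) *\<^sub>R (axis 1 1 \<times> axis 2 1)"
      by (simp add: vec_eq_iff forall_3 cross3_simps axis_def)
    show ?thesis
      by (subst (1 2) z)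
        (simp add: matrix_vector_right_distrib matrix_vector_mult_scaleR * algebra_simps del: transpose_matrix_vector)
  qed
  then have "(transpose ?A ** lorentz ** ?A ** lorentz) *v z = (det ?A *\<^sub>R mat 1) *v z" for z
    by (simp add: matrix_vector_mul_assoc[symmetric] scaleR_matrix_vector_assoc[symmetric])
  then have "transpose ?A ** lorentz ** ?A ** lorentz = det ?A *\<^sub>R mat 1"
    by (simp add: matrix_eq)
  then have "transpose ?A ** lorentz ** ?A ** (lorentz ** lorentz) = det ?A *\<^sub>R lorentz"
    by (simp add: matrix_mul_assoc scalar_matrix_assoc[symmetric])
  then have e: "transpose ?A ** lorentz ** ?A = det ?A *\<^sub>R lorentz"
    by (simp add: lorentz_squared)
  have "det ?A * (-1) * det ?A = det ?A ^ 3 * (-1)"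
    using arg_cong[OF e, of det] by (simp add: det_mul det_lorentz det_scaleR_lorentz)
  then have "det ?A = 1" using inv by (simp add: power3_eq_cube)
  with e show "lorentz_matrix ?A" by (simp add: lorentz_matrix_def)
next
  let ?A = "frame_matrix V"
  assume A: "lorentz_matrix ?A"
  have inj: "inj (\<lambda>x. ?A *v x)"
    using lorentz_matrix_inverse[OF lorentz_matrix_gram[OF A]] matrix_left_invertible_injective by blast
  have surj: "surj (\<lambda>x. ?A *v x)"
    using lorentz_matrix_inverse[OF lorentz_matrix_gram[OF A]] matrix_right_invertible_surjective by blast
  have V: "V = (\<lambda>x. ?A *v x) \<circ> (\<lambda>i. axis i 1)" by (simp add: fun_eq_iff)
  have rV: "range V = (\<lambda>x. ?A *v x) ` range (\<lambda>i. axis i 1)"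
    by (subst V) (simp add: image_comp)
  have "inj V"
    by (subst V) (use inj sl2_basis_axis in \<open>simp add: sl2_basis_def inj_compose\<close>)
  moreover have "independent (range V)"
    unfolding rV using inj sl2_basis_axis
    by (intro linear_independent_injective_image) (auto simp: sl2_basis_def)
  moreover have "span (range V) = UNIV"
    unfolding rV using surj sl2_basis_axis
    by (subst linear_span_image) (auto simp: sl2_basis_def)
  moreover have "sl2_bracket (V i) (V j) =
        (\<Sum>k\<in>UNIV. (levi_civita_symbol i j k * sl2_const k) *\<^sub>R V k)" for i j
    using lorentz_matrix_bracket[OF A, of "axis i 1" "axis j 1"] sl2_basis_axis unfolding sl2_basis_def
    by (simp add: matrix_vector_right_distrib sum_3 matrix_vector_mult_scaleR)
  ultimately show "sl2_basis V" by (simp add: sl2_basis_def)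
qed

section \<open>The Ricci curvature of a metric that is diagonal in a frame\<close>

definition diag_form :: "real \<Rightarrow> real \<Rightarrow> real \<Rightarrow> real ^ 3 \<Rightarrow> real ^ 3 \<Rightarrow> real" where
  "diag_form a b d x y = a * x $ 1 * y $ 1 + b * x $ 2 * y $ 2 + d * x $ 3 * y $ 3"

lemma bilinear_diag_form: "bilinear (diag_form a b d)"
  unfolding bilinear_def
  by (auto intro!: linearI simp: diag_form_def algebra_simps)

lemma diag_form_metric:
  assumes "a > 0" "b > 0" "d > 0"
  shows "left_invariant_metric (diag_form a b d)"
proof -
  have "diag_form a b d x x > 0" if "x \<noteq> 0" for x
  proof -
    have sq: "diag_form a b d x x = a * (x$1)\<^sup>2 + b * (x$2)\<^sup>2 + d * (x$3)\<^sup>2"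
      by (simp add: diag_form_def power2_eq_square)
    have "x$1 \<noteq> 0 \<or> x$2 \<noteq> 0 \<or> x$3 \<noteq> 0"
      using that by (auto simp: vec_eq_iff forall_3)
    then have "a * (x$1)\<^sup>2 > 0 \<or> b * (x$2)\<^sup>2 > 0 \<or> d * (x$3)\<^sup>2 > 0"
      using assms by auto
    moreover have "a * (x$1)\<^sup>2 \<ge> 0" "b * (x$2)\<^sup>2 \<ge> 0" "d * (x$3)\<^sup>2 \<ge> 0"
      using assms by auto
    ultimately show ?thesis unfolding sq by linarith
  qed
  then show ?thesis
    by (auto simp: left_invariant_metric_def bilinear_diag_form) (simp add: diag_form_def)
qed

text \<open>The predicate by which the Levi-Civita connection is characterised in its definition by a definite
  description.\<close>

definition is_levi_civita ::
  "(real ^ 3 \<Rightarrow> real ^ 3 \<Rightarrow> real) \<Rightarrow> (real ^ 3 \<Rightarrow> real ^ 3 \<Rightarrow> real ^ 3) \<Rightarrow> bool" where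
  "is_levi_civita g D \<longleftrightarrow> bilinear D \<and>
     (\<forall>x y. D x y - D y x = sl2_bracket x y) \<and>
     (\<forall>x y z. g (D x y) z + g y (D x z) = 0)"

text \<open>The difference \<open>E\<close> of two such connections is symmetric in its arguments while
  \<open>g (E x y) z\<close> is skew in \<open>y, z\<close>; a trilinear expression that is symmetric in one pair and skew in
  another vanishes.\<close>

lemma levi_civita_unique:
  assumes g: "left_invariant_metric g" and D: "is_levi_civita g D" and D': "is_levi_civita g D'"
  shows "D = D'"
proof -
  define E where "E = (\<lambda>x y. D x y - D' x y)"
  have bg: "bilinear g" and sg: "g x y = g y x" and pg: "x \<noteq> 0 \<Longrightarrow> g x x > 0" for x y
    using g by (auto simp: left_invariant_metric_def)
  have sE: "E x y = E y x" for x y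
  proof -
    have "D x y - D y x = D' x y - D' y x"
      using D D' by (simp add: is_levi_civita_def)
    then show ?thesis by (simp add: E_def algebra_simps)
  qed
  have aE: "g (E x y) z = - g (E x z) y" for x y z
  proof -
    have "g (D x y) z + g y (D x z) = 0" "g (D' x y) z + g y (D' x z) = 0"
      using D D' by (auto simp: is_levi_civita_def)
    then show ?thesis
      by (simp add: E_def bilinear_lsub[OF bg] bilinear_rsub[OF bg] sg)
  qed
  have "g (E x y) z = 0" for x y z
  proof -
    have "g (E x y) z = - g (E x z) y" by (rule aE)
    also have "\<dots> = - g (E z x) y" by (simp add: sE)
    also have "\<dots> = g (E z y) x" using aE[of z x y] by simp
    also have "\<dots> = g (E y z) x" by (simp add: sE)
    also have "\<dots> = - g (E y x) z" by (rule aE)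
    also have "\<dots> = - g (E x y) z" by (simp add: sE)
    finally show ?thesis by simp
  qed
  then have "E x y = 0" for x y
    using pg[of "E x y"] by fastforce
  then show ?thesis by (simp add: E_def fun_eq_iff)
qed

lemma levi_civita_connection_eqI:
  assumes "left_invariant_metric g" "is_levi_civita g D"
  shows "levi_civita_connection g = D"
  unfolding levi_civita_connection_def
  using assms levi_civita_unique[OF assms(1)]
  by (intro the_equality) (auto simp: is_levi_civita_def)

text \<open>The solution of the Koszul formula for the metric \<open>diag(a, b, d)\<close>. It is
  \<open>diag(a, b, d)\<^sup>-\<^sup>1 (M x \<times> y)\<close> with \<open>M = diag(b - a - d, a - b - d, a + b + d)\<close>.\<close>

definition diag_connection :: "real \<Rightarrow> real \<Rightarrow> real \<Rightarrow> real ^ 3 \<Rightarrow> real ^ 3 \<Rightarrow> real ^ 3" where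
  "diag_connection a b d x y = vector
     [((a - b - d) * x $ 2 * y $ 3 - (a + b + d) * x $ 3 * y $ 2) / a,
      ((a + b + d) * x $ 3 * y $ 1 - (b - a - d) * x $ 1 * y $ 3) / b,
      ((b - a - d) * x $ 1 * y $ 2 - (a - b - d) * x $ 2 * y $ 1) / d]"

lemma diag_connection_nth [simp]:
  "diag_connection a b d x y $ 1 = ((a - b - d) * x $ 2 * y $ 3 - (a + b + d) * x $ 3 * y $ 2) / a"
  "diag_connection a b d x y $ 2 = ((a + b + d) * x $ 3 * y $ 1 - (b - a - d) * x $ 1 * y $ 3) / b"
  "diag_connection a b d x y $ 3 = ((b - a - d) * x $ 1 * y $ 2 - (a - b - d) * x $ 2 * y $ 1) / d"
  by (simp_all add: diag_connection_def)

lemma diag_connection_levi_civita: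
  assumes "a \<noteq> 0" "b \<noteq> 0" "d \<noteq> 0"
  shows "is_levi_civita (diag_form a b d) (diag_connection a b d)"
  unfolding is_levi_civita_def
proof (intro conjI allI)
  show "bilinear (diag_connection a b d)"
    unfolding bilinear_def
    by (auto intro!: linearI simp: vec_eq_iff forall_3 add_divide_distrib diff_divide_distrib algebra_simps)
  show "diag_connection a b d x y - diag_connection a b d y x = sl2_bracket x y" for x y
    using assms by (simp add: vec_eq_iff forall_3 sl2_bracket_components field_simps)
  show "diag_form a b d (diag_connection a b d x y) z + diag_form a b d y (diag_connection a b d x z) = 0" for x y z
    using assms by (simp add: diag_form_def) (simp add: algebra_simps)
qed

text \<open>For the metric \<open>diag(a, b, d)\<close>, \<open>ricci1 a b d\<close> is the first diagonal entry of the Ricci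
  tensor. The first two basis vectors play symmetric roles, so that the second entry is
  \<open>ricci1 b a d\<close>.\<close>

definition ricci1 :: "real \<Rightarrow> real \<Rightarrow> real \<Rightarrow> real" where
  "ricci1 a b d = 2 * (a - b - d) * (a + b + d) / (b * d)"

definition ricci3 :: "real \<Rightarrow> real \<Rightarrow> real \<Rightarrow> real" where
  "ricci3 a b d = 2 * (d - a + b) * (d + a - b) / (a * b)"

text \<open>The Riemann tensor of \<open>diag(a, b, d)\<close> in the standard basis, with the connection already made
  explicit.\<close>

definition diag_curvature :: "real \<Rightarrow> real \<Rightarrow> real \<Rightarrow> real ^ 3 \<Rightarrow> real ^ 3 \<Rightarrow> real ^ 3 \<Rightarrow> real ^ 3" where
  "diag_curvature a b d x y z =
     (let D = diag_connection a b d in D x (D y z) - D y (D x z) - D (sl2_bracket x y) z)"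

lemma linear_diag_curvature:
  assumes "a \<noteq> 0" "b \<noteq> 0" "d \<noteq> 0"
  shows "linear (\<lambda>x. diag_curvature a b d x y z)"
proof -
  have b: "bilinear (diag_connection a b d)"
    using diag_connection_levi_civita[OF assms] by (simp add: is_levi_civita_def)
  note s = bilinear_sl2_bracket
  show ?thesis
    unfolding diag_curvature_def Let_def
    by (auto intro!: linearI simp: bilinear_ladd[OF b] bilinear_radd[OF b] bilinear_lmul[OF b]
      bilinear_rmul[OF b] bilinear_ladd[OF s] bilinear_lmul[OF s] algebra_simps)
qed

text \<open>With the six coefficients of the connection treated as independent unknowns, the trace is a
  polynomial identity; the denominators enter only when the three diagonal entries are compared.\<close>

lemma trace_diag_curvature:
  assumes "a \<noteq> 0" "b \<noteq> 0" "d \<noteq> 0"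
  shows "trace (matrix (\<lambda>x. diag_curvature a b d x y z)) =
     diag_form (ricci1 a b d) (ricci1 b a d) (ricci3 a b d) y z"
proof -
  define P P' where "P = (a - b - d) / a" and "P' = (a + b + d) / a"
  define Q Q' where "Q = (a + b + d) / b" and "Q' = (b - a - d) / b"
  define R R' where "R = (b - a - d) / d" and "R' = (a - b - d) / d"
  define D where "D = diag_connection a b d"
  have D: "D x y $ 1 = P * x $ 2 * y $ 3 - P' * x $ 3 * y $ 2"
    "D x y $ 2 = Q * x $ 3 * y $ 1 - Q' * x $ 1 * y $ 3"
    "D x y $ 3 = R * x $ 1 * y $ 2 - R' * x $ 2 * y $ 1" for x y
    by (simp_all add: D_def P_def P'_def Q_def Q'_def R_def R'_def diff_divide_distrib[of "u * v * w" for u v w])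
  have e: "axis 1 (1::real) $ (1::3) = 1" "axis 1 (1::real) $ (2::3) = 0" "axis 1 (1::real) $ (3::3) = 0"
    "axis 2 (1::real) $ (1::3) = 0" "axis 2 (1::real) $ (2::3) = 1" "axis 2 (1::real) $ (3::3) = 0"
    "axis 3 (1::real) $ (1::3) = 0" "axis 3 (1::real) $ (2::3) = 0" "axis 3 (1::real) $ (3::3) = 1"
    by (simp_all add: axis_def)
  have "trace (matrix (\<lambda>x. diag_curvature a b d x y z)) =
      diag_form (2 * R' - 2 * Q - Q' * R' - Q * R) (2 * R - 2 * P' - P * R - P' * R')
        (2 * P + 2 * Q' - P' * Q' - P * Q) y z"
    unfolding trace_def matrix_def sum_3 diag_curvature_def Let_def D_def[symmetric] diag_form_def
    by (simp add: D e sl2_bracket_components) (simp add: algebra_simps)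
  moreover have "2 * R' - 2 * Q - Q' * R' - Q * R = ricci1 a b d"
    using assms by (simp add: Q_def Q'_def R_def R'_def ricci1_def field_simps)
  moreover have "2 * R - 2 * P' - P * R - P' * R' = ricci1 b a d"
    using assms by (simp add: P_def P'_def R_def R'_def ricci1_def field_simps)
  moreover have "2 * P + 2 * Q' - P' * Q' - P * Q = ricci3 a b d"
    using assms by (simp add: P_def P'_def Q_def Q'_def ricci3_def field_simps)
  ultimately show ?thesis by simp
qed

text \<open>A Lorentz matrix \<open>A\<close> is an automorphism of the Lie algebra, so it transports the connection of
  \<open>diag(a, b, d)\<close> to that of \<open>g\<close>, and the trace in the Ricci tensor is invariant under conjugation
  with \<open>A\<close>.\<close>

lemma Ric_diagonal_frame:
  assumes A: "lorentz_matrix A" and pos: "a > 0" "b > 0" "d > 0"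
    and g: "left_invariant_metric g" and diag: "\<And>x y. g (A *v x) (A *v y) = diag_form a b d x y"
  shows "Ric g (A *v y) (A *v z) = diag_form (ricci1 a b d) (ricci1 b a d) (ricci3 a b d) y z"
proof -
  define B where "B = lorentz_inverse A"
  have BA: "B *v (A *v x) = x" and AB: "A *v (B *v x) = x" for x
    using lorentz_matrix_inverse[OF lorentz_matrix_gram[OF A]] by (simp_all add: B_def matrix_vector_mul_assoc)
  let ?K = "diag_connection a b d"
  define D where "D = (\<lambda>x y. A *v ?K (B *v x) (B *v y))"
  have nz: "a \<noteq> 0" "b \<noteq> 0" "d \<noteq> 0" using pos by auto
  note K = diag_connection_levi_civita[OF nz, unfolded is_levi_civita_def]
  have "is_levi_civita g D"
    unfolding is_levi_civita_def
  proof (intro conjI allI)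
    show "bilinear D" unfolding D_def
      using bilinear_compose_linear[of ?K "(*v) B" "(*v) A"] K by simp
    show "D x y - D y x = sl2_bracket x y" for x y
    proof -
      have "D x y - D y x = A *v (?K (B *v x) (B *v y) - ?K (B *v y) (B *v x))"
        by (simp add: D_def matrix_vector_mult_diff_distrib)
      also have "\<dots> = sl2_bracket (A *v (B *v x)) (A *v (B *v y))"
        using K by (simp add: lorentz_matrix_bracket[OF A])
      finally show ?thesis by (simp add: AB)
    qed
    show "g (D x y) z + g y (D x z) = 0" for x y z
    proof -
      have "g (D x y) (A *v (B *v z)) + g (A *v (B *v y)) (D x z) = 0"
        using K unfolding D_def diag by blast
      then show ?thesis by (simp add: AB)
    qed
  qed
  then have D: "levi_civita_connection g = D"
    by (rule levi_civita_connection_eqI[OF g])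
  have Bbr: "B *v sl2_bracket x y = sl2_bracket (B *v x) (B *v y)" for x y
    by (metis AB BA lorentz_matrix_bracket[OF A])
  have R: "riemann_curvature g x (A *v y) (A *v z) = A *v diag_curvature a b d (B *v x) y z" for x
    unfolding riemann_curvature_def D diag_curvature_def
    by (simp add: Let_def D_def BA Bbr matrix_vector_mult_diff_distrib)
  let ?M = "matrix (\<lambda>x. diag_curvature a b d x y z)"
  have "(\<lambda>x. riemann_curvature g x (A *v y) (A *v z)) = (\<lambda>x. (A ** ?M ** B) *v x)"
    unfolding R by (simp add: matrix_vector_mul_assoc[symmetric] matrix_works linear_diag_curvature nz)
  then have "Ric g (A *v y) (A *v z) = trace (A ** ?M ** B)"
    by (simp add: Ric_def)
  also have "\<dots> = trace (B ** A ** ?M)"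
    using trace_mul_sym[of "A ** ?M" B] by (simp add: matrix_mul_assoc)
  also have "\<dots> = trace ?M"
    using lorentz_matrix_inverse(1)[OF lorentz_matrix_gram[OF A]] by (simp add: B_def)
  finally show ?thesis by (simp add: trace_diag_curvature[OF nz])
qed

section \<open>Every metric is diagonal in some frame\<close>

text \<open>The vector \<open>v\<close> maximises the Rayleigh quotient of \<open>B\<close> over \<open>g\<close> on \<open>U\<close>, and \<open>\<mu>\<close> is the
  maximum. Then \<open>B - \<mu> g\<close> is negative semidefinite on \<open>U\<close> with \<open>v\<close> in its null cone, and for
  a semidefinite form a null vector is in the radical.\<close>

lemma rayleigh_critical_vector:
  fixes g B :: "'a::euclidean_space \<Rightarrow> 'a \<Rightarrow> real"
  assumes bg: "bilinear g" and sg: "\<And>x y. g x y = g y x" and pg: "\<And>x. x \<noteq> 0 \<Longrightarrow> g x x > 0"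
    and bB: "bilinear B" and sB: "\<And>x y. B x y = B y x"
    and U: "subspace U" and ne: "x0 \<in> U" "x0 \<noteq> 0"
  obtains v \<mu> where "v \<in> U" "v \<noteq> 0" "\<And>y. y \<in> U \<Longrightarrow> B v y = \<mu> * g v y"
proof -
  define S where "S = U \<inter> sphere 0 1"
  define f where "f = (\<lambda>x. B x x / g x x)"
  have "compact S" unfolding S_def
    using closed_subspace[OF U] by (simp add: closed_Int_compact)
  moreover have "(1 / norm x0) *\<^sub>R x0 \<in> S"
    using ne U by (simp add: S_def subspace_scale)
  then have "S \<noteq> {}" by blast
  moreover have "continuous_on S f"
  proof -
    have "g x x \<noteq> 0" if "x \<in> S" for x
    proof -
      have "x \<noteq> 0" using that by (auto simp: S_def)
      then show ?thesis using pg[of x] by simp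
    qed
    then show ?thesis unfolding f_def
      by (intro continuous_on_divide bilinear_continuous_on_compose[OF _ _ bB]
        bilinear_continuous_on_compose[OF _ _ bg] continuous_on_id) auto
  qed
  ultimately obtain v where v: "v \<in> S" "\<And>y. y \<in> S \<Longrightarrow> f y \<le> f v"
    using continuous_attains_sup[of S f] by metis
  define \<mu> where "\<mu> = f v"
  define Q where "Q = (\<lambda>x y. B x y - \<mu> * g x y)"
  have vU: "v \<in> U" "v \<noteq> 0" using v(1) by (auto simp: S_def)
  have Qexp: "Q (v + t *\<^sub>R y) (v + t *\<^sub>R y) = Q v v + 2 * t * Q v y + t\<^sup>2 * Q y y" for t y
    using sB[of y v] sg[of y v]
    by (simp add: Q_def bilinear_ladd[OF bg] bilinear_radd[OF bg] bilinear_lmul[OF bg]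
      bilinear_rmul[OF bg] bilinear_ladd[OF bB] bilinear_radd[OF bB] bilinear_lmul[OF bB]
      bilinear_rmul[OF bB] algebra_simps power2_eq_square)
  have Qneg: "Q x x \<le> 0" if "x \<in> U" for x
  proof (cases "x = 0")
    case True
    then show ?thesis by (simp add: Q_def bilinear_lzero[OF bg] bilinear_lzero[OF bB])
  next
    case False
    then have "(1 / norm x) *\<^sub>R x \<in> S"
      using that U by (simp add: S_def subspace_scale)
    then have "f ((1 / norm x) *\<^sub>R x) \<le> \<mu>" using v(2) by (simp add: \<mu>_def)
    moreover have "f ((1 / norm x) *\<^sub>R x) = f x"
      using False by (simp add: f_def bilinear_lmul[OF bg] bilinear_rmul[OF bg]
        bilinear_lmul[OF bB] bilinear_rmul[OF bB])
    ultimately have "B x x / g x x \<le> \<mu>" by (simp add: f_def)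
    then show ?thesis using pg[OF False] by (simp add: Q_def field_simps)
  qed
  have Qv: "Q v v = 0" using pg[OF vU(2)] by (simp add: Q_def \<mu>_def f_def)
  have "Q v y = 0" if "y \<in> U" for y
  proof -
    define q r where "q = Q v y" and "r = Q y y"
    have r: "r \<le> 0" using Qneg that by (simp add: r_def)
    \<comment> \<open>With this step the quadratic \<open>2 t q + t\<^sup>2 r\<close> is a positive multiple of \<open>t\<^sup>2\<close>.\<close>
    define t where "t = q / (1 - r)"
    have "v + t *\<^sub>R y \<in> U" using that vU U by (simp add: subspace_add subspace_scale)
    then have "2 * t * q + t\<^sup>2 * r \<le> 0"
      using Qneg[of "v + t *\<^sub>R y"] Qexp Qv by (simp add: q_def r_def)
    moreover have "2 * t * q + t\<^sup>2 * r = t\<^sup>2 * (2 - r)"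
    proof -
      have q: "t * (1 - r) = q" using r by (simp add: t_def)
      have "t\<^sup>2 * (2 - r) = 2 * t * (t * (1 - r)) + t\<^sup>2 * r"
        by (simp add: power2_eq_square algebra_simps)
      then show ?thesis by (simp only: q)
    qed
    ultimately have "t\<^sup>2 \<le> 0" using r by (simp add: mult_le_0_iff)
    then show ?thesis using r by (simp add: t_def q_def)
  qed
  then show ?thesis using that[OF vU, of \<mu>] by (simp add: Q_def)
qed

text \<open>Two linear conditions on a three-dimensional space; they supply the orthogonal vectors from which a
  diagonalising frame is built.\<close>

lemma common_kernel_vector:
  fixes f h :: "real ^ 3 \<Rightarrow> real"
  assumes "linear f" "linear h"
  obtains x where "x \<noteq> 0" "f x = 0" "h x = 0"
proof -
  define k where "k = (\<lambda>x. (f x, h x))"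
  have lin: "linear k"
    unfolding k_def using assms by (auto intro!: linearI simp: linear_add linear_cmul)
  have "\<not> inj k"
  proof
    assume "inj k"
    then have "dim (range k) = dim (UNIV :: (real ^ 3) set)"
      by (intro dim_image_eq[OF lin]) simp
    moreover have "dim (range k) \<le> 2"
      using dim_subset_UNIV[of "range k"] by simp
    ultimately show False by (simp add: dim_UNIV)
  qed
  then obtain x where "x \<noteq> 0" "k x = 0"
    using lin linear_injective_0 by blast
  then show ?thesis using that by (simp add: k_def prod_eq_iff)
qed

abbreviation lorentz_form :: "real ^ 3 \<Rightarrow> real ^ 3 \<Rightarrow> real" where
  "lorentz_form \<equiv> diag_form 1 1 (-1)"

definition columns_matrix :: "real ^ 3 \<Rightarrow> real ^ 3 \<Rightarrow> real ^ 3 \<Rightarrow> real ^ 3 ^ 3" where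
  "columns_matrix u v w = transpose (vector [u, v, w])"

lemma columns_matrix_nth [simp]:
  "columns_matrix u v w $ i $ 1 = u $ i" "columns_matrix u v w $ i $ 2 = v $ i"
  "columns_matrix u v w $ i $ 3 = w $ i"
  by (simp_all add: columns_matrix_def transpose_def)

lemma columns_matrix_vector:
  "columns_matrix u v w *v x = (x $ 1) *\<^sub>R u + (x $ 2) *\<^sub>R v + (x $ 3) *\<^sub>R w"
  by (simp add: vec_eq_iff forall_3 matrix_vector_mult_def sum_3 mult.commute)

lemma bilinear_orthogonal_columns:
  assumes f: "bilinear f" and s: "\<And>x y. f x y = f y x"
    and o: "f u v = 0" "f u w = 0" "f v w = 0"
  shows "f (columns_matrix u v w *v x) (columns_matrix u v w *v y) =
    diag_form (f u u) (f v v) (f w w) x y"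
  using o s[of v u] s[of w u] s[of w v]
  by (simp add: columns_matrix_vector bilinear_ladd[OF f] bilinear_radd[OF f] bilinear_lmul[OF f]
      bilinear_rmul[OF f] diag_form_def)

lemma columns_gram:
  "transpose (columns_matrix u v w) ** lorentz ** columns_matrix u v w = lorentz \<longleftrightarrow>
    lorentz_form u u = 1 \<and> lorentz_form v v = 1 \<and> lorentz_form w w = -1 \<and>
    lorentz_form u v = 0 \<and> lorentz_form u w = 0 \<and> lorentz_form v w = 0"
  by (auto simp: mat3_eq_iff matrix_matrix_mult_def sum_3 transpose_def diag_form_def algebra_simps)

lemma diag_form_sym: "diag_form a b d x y = diag_form a b d y x"
  by (simp add: diag_form_def)

text \<open>Rescaling the three vectors makes the matrix preserve the Lorentz form; flipping the sign of \<open>w\<close>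
  adjusts the determinant.\<close>

lemma normalised_frame:
  assumes g: "left_invariant_metric g"
    and gO: "g u v = 0" "g u w = 0" "g v w = 0"
    and O: "lorentz_form u v = 0" "lorentz_form u w = 0" "lorentz_form v w = 0"
    and sig: "lorentz_form u u > 0" "lorentz_form v v > 0" "lorentz_form w w < 0"
  obtains A a b d where "lorentz_matrix A" "a > 0" "b > 0" "d > 0"
    "\<And>x y. g (A *v x) (A *v y) = diag_form a b d x y"
proof -
  have bg: "bilinear g" and sg: "g x y = g y x" and pg: "x \<noteq> 0 \<Longrightarrow> g x x > 0" for x y
    using g by (auto simp: left_invariant_metric_def)
  note bl = bilinear_diag_form
  define u' where "u' = (1 / sqrt (lorentz_form u u)) *\<^sub>R u"
  define v' where "v' = (1 / sqrt (lorentz_form v v)) *\<^sub>R v"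
  define w' where "w' = (\<lambda>s. (s / sqrt (- lorentz_form w w)) *\<^sub>R w)"
  define A where "A = (\<lambda>s. columns_matrix u' v' (w' s))"
  have gram: "transpose (A s) ** lorentz ** A s = lorentz" if "s * s = 1" for s
    unfolding A_def columns_gram u'_def v'_def w'_def
    using O sig that by (simp add: bilinear_lmul[OF bl] bilinear_rmul[OF bl])
  have det: "det (A (-1)) = - det (A 1)"
    by (simp add: det_3 A_def w'_def)
  have "- det (A 1) * det (A 1) = - 1"
    using arg_cong[OF gram[of 1], of det] by (simp add: det_mul det_lorentz)
  then have "(det (A 1) - 1) * (det (A 1) + 1) = 0"
    by (simp add: algebra_simps)
  then have "det (A 1) = 1 \<or> det (A (-1)) = 1"
    unfolding det by auto
  then obtain s where s: "s * s = 1" "det (A s) = 1"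
    by (metis mult_1 mult_minus1 minus_minus)
  have "u \<noteq> 0" "v \<noteq> 0" "w \<noteq> 0" using sig by (auto simp: diag_form_def)
  then have nz: "u' \<noteq> 0" "v' \<noteq> 0" "w' s \<noteq> 0"
    using s sig unfolding u'_def v'_def w'_def by auto
  show ?thesis
  proof (rule that)
    show "lorentz_matrix (A s)" using s gram by (simp add: lorentz_matrix_def)
    show "g u' u' > 0" "g v' v' > 0" "g (w' s) (w' s) > 0" using nz pg by auto
    show "g (A s *v x) (A s *v y) = diag_form (g u' u') (g v' v') (g (w' s) (w' s)) x y" for x y
      unfolding A_def
      by (rule bilinear_orthogonal_columns[OF bg sg])
        (simp_all add: u'_def v'_def w'_def bilinear_lmul[OF bg] bilinear_rmul[OF bg] gO)
  qed
qed

text \<open>Two Rayleigh vectors and a vector orthogonal to both diagonalise \<open>g\<close> and the Lorentz form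
  simultaneously. The diagonal entries of the Lorentz form have negative product, and they are not
  all negative since the form takes the value 1; so exactly one is negative, and that vector has to be
  placed last.\<close>

lemma milnor_frame:
  assumes g: "left_invariant_metric g"
  obtains A a b d where "lorentz_matrix A" "a > 0" "b > 0" "d > 0"
    "\<And>x y. g (A *v x) (A *v y) = diag_form a b d x y"
proof -
  have bg: "bilinear g" and sg: "\<And>x y. g x y = g y x" and pg: "\<And>x. x \<noteq> 0 \<Longrightarrow> g x x > 0"
    using g by (auto simp: left_invariant_metric_def)
  have lg: "linear (g x)" for x using bg by (simp add: bilinear_def)
  let ?L = lorentz_form
  obtain u \<mu> where u: "u \<noteq> 0" "\<And>y. ?L u y = \<mu> * g u y"
    using rayleigh_critical_vector[OF bg sg pg bilinear_diag_form diag_form_sym subspace_UNIV UNIV_I,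
      of "axis 1 1"] by (metis UNIV_I axis_eq_0_iff zero_neq_one)
  obtain x0 where x0: "x0 \<noteq> 0" "g u x0 = 0"
    using common_kernel_vector[OF lg lg] by metis
  have U: "subspace {x. g u x = 0}"
    using lg by (auto intro!: subspaceI simp: linear_0 linear_add linear_cmul)
  obtain v \<nu> where v: "g u v = 0" "v \<noteq> 0" "\<And>y. g u y = 0 \<Longrightarrow> ?L v y = \<nu> * g v y"
    using rayleigh_critical_vector[OF bg sg pg bilinear_diag_form diag_form_sym U, of x0 1 1 "-1"] x0
    by auto
  obtain w where w: "w \<noteq> 0" "g u w = 0" "g v w = 0"
    using common_kernel_vector[OF lg lg] by metis
  have O: "?L u v = 0" "?L u w = 0" "?L v w = 0"
    using u(2) v(3) v(1) w by simp_all
  define P where "P = columns_matrix u v w"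
  have gP: "g (P *v x) (P *v y) = diag_form (g u u) (g v v) (g w w) x y" for x y
    unfolding P_def by (rule bilinear_orthogonal_columns[OF bg sg v(1) w(2,3)])
  have LP: "?L (P *v x) (P *v y) = diag_form (?L u u) (?L v v) (?L w w) x y" for x y
    unfolding P_def by (rule bilinear_orthogonal_columns[OF bilinear_diag_form diag_form_sym O])
  have "x = 0" if "P *v x = 0" for x
  proof (rule ccontr)
    assume "x \<noteq> 0"
    then have "diag_form (g u u) (g v v) (g w w) x x > 0"
      using diag_form_metric[of "g u u" "g v v" "g w w"] pg u v w
      by (auto simp: left_invariant_metric_def)
    then show False using gP[of x x] that by (simp add: bilinear_lzero[OF bg])
  qed
  then have inv: "invertible P"
    by (simp add: invertible_left_inverse matrix_left_invertible_ker)
  then have detP: "det P \<noteq> 0" by (simp add: invertible_det_nz)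
  have "transpose P ** lorentz ** P = (\<chi> i j. if i = j then (if i = 1 then ?L u u else if i = 2 then ?L v v else ?L w w) else 0)"
    using O unfolding P_def
    by (simp add: mat3_eq_iff matrix_matrix_mult_def sum_3 transpose_def diag_form_def algebra_simps)
  then have "det (transpose P ** lorentz ** P) = ?L u u * ?L v v * ?L w w"
    by (simp add: det_3)
  then have "?L u u * ?L v v * ?L w w = - (det P)\<^sup>2"
    by (simp add: det_mul det_lorentz power2_eq_square)
  with detP have prod: "?L u u * ?L v v * ?L w w < 0" by simp
  obtain x where x: "P *v x = axis 1 1"
    using inv by (metis invertible_right_inverse matrix_right_invertible_surjective surjD)
  have "?L u u * (x$1)\<^sup>2 + ?L v v * (x$2)\<^sup>2 + ?L w w * (x$3)\<^sup>2 = 1"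
    using LP[of x x] unfolding x by (simp add: diag_form_def power2_eq_square axis_def)
  then have "\<not> (?L u u \<le> 0 \<and> ?L v v \<le> 0 \<and> ?L w w \<le> 0)"
    by (smt (verit) mult_nonpos_nonneg zero_le_power2)
  then consider "?L u u > 0" "?L v v > 0" "?L w w < 0" | "?L u u > 0" "?L w w > 0" "?L v v < 0"
    | "?L v v > 0" "?L w w > 0" "?L u u < 0"
    using prod by (auto simp: mult_less_0_iff zero_less_mult_iff)
  then show ?thesis
  proof cases
    case 1
    then show ?thesis using normalised_frame[OF g v(1) w(2,3) O] that by metis
  next
    case 2
    have "g w v = 0" "?L w v = 0" using w O sg diag_form_sym by metis+
    then show ?thesis using normalised_frame[OF g w(2) v(1) _ O(2) O(1)] 2 that by metis
  next
    case 3
    have "g w u = 0" "?L w u = 0" "g v u = 0" "?L v u = 0"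
      using v w O sg diag_form_sym by metis+
    then show ?thesis using normalised_frame[OF g w(3) _ _ O(3)] 3 that by metis
  qed
qed

section \<open>Signs of the Ricci curvatures\<close>

text \<open>The equation \<open>Ric g = c T\<close> for \<open>g = diag(a, b, d)\<close> and \<open>T = diag(T1, T2, T3)\<close> in a common
  frame.\<close>

definition prescribes :: "real \<Rightarrow> real \<Rightarrow> real \<Rightarrow> real \<Rightarrow> real \<Rightarrow> real \<Rightarrow> real \<Rightarrow> bool" where
  "prescribes T1 T2 T3 a b d c \<longleftrightarrow> a > 0 \<and> b > 0 \<and> d > 0 \<and> c > 0 \<and>
     ricci1 a b d = c * T1 \<and> ricci1 b a d = c * T2 \<and> ricci3 a b d = c * T3"

lemma cases_scale:
  assumes "c > 0"
  shows "cases_i_to_iv (c * T1) (c * T2) (c * T3) \<longleftrightarrow> cases_i_to_iv T1 T2 T3"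
    and "cases_v_to_vii (c * T1) (c * T2) (c * T3) \<longleftrightarrow> cases_v_to_vii T1 T2 T3"
proof -
  have m: "- (c * x) < c * y \<longleftrightarrow> - x < y" "c * y < - (c * x) \<longleftrightarrow> y < - x"
    "c * x = - (c * y) \<longleftrightarrow> x = - y" for x y
    using assms mult_less_cancel_left_pos[of c "-x" y] mult_less_cancel_left_pos[of c y "-x"]
      mult_cancel_left[of c x "-y"] by auto
  show "cases_i_to_iv (c * T1) (c * T2) (c * T3) \<longleftrightarrow> cases_i_to_iv T1 T2 T3"
    using assms by (simp add: cases_i_to_iv_def zero_less_mult_iff mult_less_0_iff m)
  show "cases_v_to_vii (c * T1) (c * T2) (c * T3) \<longleftrightarrow> cases_v_to_vii T1 T2 T3"
    using assms by (simp add: cases_v_to_vii_def zero_less_mult_iff mult_less_0_iff m)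
qed

text \<open>The factorisation of the sums is what produces the comparisons between \<open>T3\<close> and \<open>- T1\<close>,
  \<open>- T2\<close> in the seven cases.\<close>

lemma ricci_sums:
  assumes "a \<noteq> 0" "b \<noteq> 0" "d \<noteq> 0"
  shows "ricci1 a b d + ricci3 a b d = (a - b - d) * (a + b - d) * (2 * (a + d) / (a * b * d))"
    and "ricci1 b a d + ricci3 a b d = (b - a - d) * (a + b - d) * (2 * (b + d) / (a * b * d))"
  using assms by (simp_all add: ricci1_def ricci3_def field_simps)

text \<open>Up to positive factors the curvatures are \<open>p\<close>, \<open>q\<close>, \<open>p q\<close>, and their sums with the third one
  are \<open>p k\<close>, \<open>q k\<close>, where \<open>p = a - b - d\<close>, \<open>q = b - a - d\<close>, \<open>k = a + b - d\<close>. Since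
  \<open>p + q < 0\<close> and \<open>p, q < k\<close>, only seven sign patterns can occur, and they are the seven cases.\<close>

lemma ricci_classification:
  assumes "a > 0" "b > 0" "d > 0"
  shows "cases_i_to_iv (ricci1 a b d) (ricci1 b a d) (ricci3 a b d) \<or>
    cases_v_to_vii (ricci1 a b d) (ricci1 b a d) (ricci3 a b d)"
proof -
  define p q k where "p = a - b - d" and "q = b - a - d" and "k = a + b - d"
  define R1 R2 R3 where "R1 = ricci1 a b d" and "R2 = ricci1 b a d" and "R3 = ricci3 a b d"
  obtain s1 where s1: "s1 > 0" "R1 = p * s1"
  proof
    show "2 * (a + b + d) / (b * d) > 0" using assms by simp
  qed (use assms in \<open>simp add: R1_def ricci1_def p_def field_simps\<close>)
  obtain s2 where s2: "s2 > 0" "R2 = q * s2"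
  proof
    show "2 * (a + b + d) / (a * d) > 0" using assms by simp
  qed (use assms in \<open>simp add: R2_def ricci1_def q_def field_simps\<close>)
  obtain s3 where s3: "s3 > 0" "R3 = p * q * s3"
  proof
    show "2 / (a * b) > 0" using assms by simp
  qed (use assms in \<open>simp add: R3_def ricci3_def p_def q_def field_simps\<close>)
  obtain s4 where s4: "s4 > 0" "R1 + R3 = p * k * s4"
  proof
    show "2 * (a + d) / (a * b * d) > 0" using assms by simp
  qed (use assms ricci_sums in \<open>simp add: R1_def R3_def p_def k_def\<close>)
  obtain s5 where s5: "s5 > 0" "R2 + R3 = q * k * s5"
  proof
    show "2 * (b + d) / (a * b * d) > 0" using assms by simp
  qed (use assms ricci_sums in \<open>simp add: R2_def R3_def q_def k_def\<close>)
  have pq: "p + q < 0" and pk: "p < k" "q < k" using assms by (auto simp: p_def q_def k_def)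
  note sgn = zero_less_mult_iff mult_less_0_iff s1(1) s2(1) s3(1) s4(1) s5(1)
  consider "p > 0" | "q > 0" | "p = 0" | "q = 0" | "p < 0" "q < 0" "k < 0" | "p < 0" "q < 0" "k = 0"
    | "p < 0" "q < 0" "k > 0" by linarith
  then have "cases_i_to_iv R1 R2 R3 \<or> cases_v_to_vii R1 R2 R3"
  proof cases
    case 1
    then have "R1 > 0" "R2 < 0" "R3 < 0"
      using pq by (simp_all add: s1(2) s2(2) s3(2) sgn)
    moreover have "R1 + R3 > 0" unfolding s4(2) using 1 pk by (simp add: sgn)
    ultimately show ?thesis by (simp add: cases_i_to_iv_def)
  next
    case 2
    then have "R2 > 0" "R1 < 0" "R3 < 0"
      using pq by (simp_all add: s1(2) s2(2) s3(2) sgn)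
    moreover have "R2 + R3 > 0" unfolding s5(2) using 2 pk by (simp add: sgn)
    ultimately show ?thesis by (simp add: cases_i_to_iv_def)
  next
    case 3
    then show ?thesis using pq s1 s2 s3 by (simp add: cases_v_to_vii_def sgn)
  next
    case 4
    then show ?thesis using pq s1 s2 s3 by (simp add: cases_v_to_vii_def sgn)
  next
    case 5
    then have "R1 < 0" "R2 < 0" "R3 > 0"
      by (simp_all add: s1(2) s2(2) s3(2) sgn)
    moreover have "R1 + R3 > 0" "R2 + R3 > 0" unfolding s4(2) s5(2) using 5 by (simp_all add: sgn)
    ultimately show ?thesis by (simp add: cases_i_to_iv_def)
  next
    case 6
    then have "R1 < 0" by (simp add: s1(2) sgn)
    moreover have "R1 + R3 = 0" "R2 + R3 = 0" unfolding s4(2) s5(2) using 6 by simp_all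
    ultimately show ?thesis by (simp add: cases_v_to_vii_def)
  next
    case 7
    then have "R1 < 0" "R2 < 0" "R3 > 0"
      by (simp_all add: s1(2) s2(2) s3(2) sgn)
    moreover have "R1 + R3 < 0" "R2 + R3 < 0" unfolding s4(2) s5(2) using 7 by (simp_all add: sgn)
    ultimately show ?thesis by (simp add: cases_i_to_iv_def)
  qed
  then show ?thesis by (simp add: R1_def R2_def R3_def)
qed

section \<open>The algebraic system in the nondegenerate cases\<close>

text \<open>The scale-invariant form of \<open>prescribes\<close>: the metric is
  \<open>diag(1 - u, 1 - v, u + v)\<close> up to scaling, and the two equations are the ratios of the three
  curvature equations with \<open>\<alpha> = - T1 / T3\<close> and \<open>\<beta> = - T2 / T3\<close>. The inequalities say that the
  metric is positive definite.\<close>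

definition reduced :: "real \<Rightarrow> real \<Rightarrow> real \<Rightarrow> real \<Rightarrow> bool" where
  "reduced \<alpha> \<beta> u v \<longleftrightarrow> u < 1 \<and> v < 1 \<and> u + v > 0 \<and>
     1 - u = \<alpha> * v * (u + v) \<and> 1 - v = \<beta> * u * (u + v)"

lemma reduced_swap: "reduced \<alpha> \<beta> u v \<longleftrightarrow> reduced \<beta> \<alpha> v u"
  by (auto simp: reduced_def add.commute)

text \<open>The range of \<open>(- T1 / T3, - T2 / T3)\<close> in cases (i)-(iv).\<close>

definition admissible :: "real \<Rightarrow> real \<Rightarrow> bool" where
  "admissible \<alpha> \<beta> \<longleftrightarrow> (\<alpha> > 1 \<and> \<beta> < 0) \<or> (\<beta> > 1 \<and> \<alpha> < 0) \<or>
     (0 < \<alpha> \<and> \<alpha> < 1 \<and> 0 < \<beta> \<and> \<beta> < 1) \<or> (\<alpha> > 1 \<and> \<beta> > 1)"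

text \<open>Multiplying out \<open>\<alpha> \<beta> w\<^sup>2 (u + v)\<close> and replacing each product by one of the two equations
  eliminates \<open>u\<close> and \<open>v\<close> in favour of \<open>w = u + v\<close>.\<close>

lemma reduced_cubic:
  assumes "reduced \<alpha> \<beta> u v"
  shows "\<alpha> * \<beta> * (u + v) ^ 3 - (1 + \<alpha> + \<beta>) * (u + v) + 2 = 0"
proof -
  define w where "w = u + v"
  have e: "1 - u = \<alpha> * v * w" "1 - v = \<beta> * u * w"
    using assms by (simp_all add: reduced_def w_def)
  have "\<alpha> * \<beta> * w ^ 3 = \<alpha> * w * (\<beta> * u * w) + \<beta> * w * (\<alpha> * v * w)"
    by (simp add: w_def power3_eq_cube algebra_simps)
  also have "\<dots> = \<alpha> * w * (1 - v) + \<beta> * w * (1 - u)" by (simp only: e)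
  also have "\<dots> = (\<alpha> + \<beta>) * w - (\<alpha> * v * w) - (\<beta> * u * w)" by (simp add: algebra_simps)
  also have "\<dots> = (\<alpha> + \<beta>) * w - (1 - u) - (1 - v)" by (simp only: e)
  finally show ?thesis unfolding w_def[symmetric] by (simp add: algebra_simps w_def)
qed

text \<open>At a root \<open>w\<close> the derivative of the cubic has the sign of \<open>\<alpha> \<beta> w\<^sup>3 - 1\<close>. The equations turn
  \<open>\<alpha> \<beta> w\<^sup>2\<close> into \<open>(1 - u) (1 - v) / (u v)\<close>, which gives this number the sign of \<open>1 - w\<close>; and
  adding the equations compares \<open>2 - w\<close> with \<open>w\<^sup>2\<close>, hence \<open>w\<close> with 1.\<close>

lemma reduced_cubic_slope:
  assumes r: "reduced \<alpha> \<beta> u v" and ad: "0 < \<alpha>" "0 < \<beta>"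
  shows "(\<alpha> < 1 \<and> \<beta> < 1 \<longrightarrow> u + v > 1 \<and> \<alpha> * \<beta> * (u + v) ^ 3 < 1) \<and>
    (\<alpha> > 1 \<and> \<beta> > 1 \<longrightarrow> u + v < 1 \<and> \<alpha> * \<beta> * (u + v) ^ 3 > 1)"
proof -
  define w where "w = u + v"
  have e: "1 - u = \<alpha> * (v * w)" "1 - v = \<beta> * (u * w)" and lt: "u < 1" "v < 1" "w > 0"
    using r by (simp_all add: reduced_def w_def)
  have vw: "v * w > 0" and uw: "u * w > 0"
    using e lt ad by (metis diff_gt_0_iff_gt zero_less_mult_pos)+
  then have pos: "u > 0" "v > 0" using lt by (simp_all add: zero_less_mult_iff)
  have sl: "(\<alpha> * \<beta> * w ^ 3) * (u * v) - u * v = (1 - w) * (w - u * v)"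
  proof -
    have "(\<alpha> * \<beta> * w ^ 3) * (u * v) = (\<alpha> * (v * w)) * (\<beta> * (u * w)) * w"
      by (simp add: power3_eq_cube)
    also have "\<dots> = (1 - u) * (1 - v) * w" by (simp only: e)
    finally show ?thesis by (simp add: w_def algebra_simps)
  qed
  have "w - u * v = u + v * (1 - u)" by (simp add: w_def algebra_simps)
  then have wuv: "w - u * v > 0" using pos lt by (simp add: add_pos_pos)
  have uv: "u * v > 0" using pos by simp
  have sg: "((\<alpha> * \<beta> * w ^ 3) - 1) * (u * v) = (1 - w) * (w - u * v)"
    using sl by (simp add: algebra_simps)
  have sum: "2 - w = \<alpha> * (v * w) + \<beta> * (u * w)" using e by (simp add: w_def)
  have sq: "v * w + u * w = w * w" by (simp add: w_def algebra_simps)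
  have fac: "w * w - (2 - w) = (w - 1) * (w + 2)" by (simp add: algebra_simps)
  show ?thesis unfolding w_def[symmetric]
  proof (intro conjI impI; (elim conjE)?)
    assume a: "\<alpha> < 1" "\<beta> < 1"
    have "\<alpha> * (v * w) < v * w" "\<beta> * (u * w) < u * w" using mult_strict_right_mono[OF a(1) vw] mult_strict_right_mono[OF a(2) uw] by simp_all
    then have "(w - 1) * (w + 2) > 0" using sum sq fac by linarith
    then show w: "w > 1" using lt by (simp add: zero_less_mult_iff)
    have "(1 - w) * (w - u * v) < 0" using w wuv by (simp add: mult_less_0_iff)
    then have "(\<alpha> * \<beta> * w ^ 3 - 1) * (u * v) < 0" unfolding sg .
    then have "\<alpha> * \<beta> * w ^ 3 - 1 < 0" using uv by (metis less_asym mult_less_0_iff)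
    then show "\<alpha> * \<beta> * w ^ 3 < 1" by simp
  next
    assume a: "\<alpha> > 1" "\<beta> > 1"
    have "\<alpha> * (v * w) > v * w" "\<beta> * (u * w) > u * w" using mult_strict_right_mono[OF a(1) vw] mult_strict_right_mono[OF a(2) uw] by simp_all
    then have "(w - 1) * (w + 2) < 0" using sum sq fac by linarith
    then show w: "w < 1" using lt by (simp add: mult_less_0_iff)
    have "(1 - w) * (w - u * v) > 0" using w wuv by simp
    then have "(\<alpha> * \<beta> * w ^ 3 - 1) * (u * v) > 0" unfolding sg .
    then have "\<alpha> * \<beta> * w ^ 3 - 1 > 0" using uv zero_less_mult_pos2 by blast
    then show "\<alpha> * \<beta> * w ^ 3 > 1" by simp
  qed
qed

text \<open>For the metric this says \<open>d \<noteq> a + b\<close>, the relation under which the cubic no longer determines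
  \<open>u\<close> and \<open>v\<close>.\<close>

lemma reduced_sum_ne_1:
  assumes r: "reduced \<alpha> \<beta> u v" and "admissible \<alpha> \<beta>"
  shows "u + v \<noteq> 1"
proof -
  have e: "1 - u = \<alpha> * v * (u + v)" "1 - v = \<beta> * u * (u + v)" and lt: "u < 1" "v < 1" "u + v > 0"
    using r by (simp_all add: reduced_def)
  consider "\<beta> < 0" | "\<alpha> < 0" | "\<alpha> > 0" "\<beta> > 0" "\<alpha> < 1 \<and> \<beta> < 1 \<or> \<alpha> > 1 \<and> \<beta> > 1"
    using assms by (auto simp: admissible_def)
  then show ?thesis
  proof cases
    case 1
    have "\<beta> * u * (u + v) > 0" using e lt by linarith
    then have "u < 0" using 1 lt by (auto simp: zero_less_mult_iff)
    then show ?thesis using lt by linarith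
  next
    case 2
    have "\<alpha> * v * (u + v) > 0" using e lt by linarith
    then have "v < 0" using 2 lt by (auto simp: zero_less_mult_iff)
    then show ?thesis using lt by linarith
  next
    case 3
    then show ?thesis using reduced_cubic_slope[OF r] by force
  qed
qed

text \<open>Two different roots \<open>w, w'\<close> of the cubic satisfy \<open>\<alpha> \<beta> w w' (w + w') = 2\<close>. This is
  impossible if \<open>\<alpha> \<beta> < 0\<close>, and also if \<open>\<alpha> \<beta> w\<^sup>3\<close> and \<open>\<alpha> \<beta> w'\<^sup>3\<close> lie on the same side of 1.
  So \<open>w = w'\<close>, and then \<open>(\<alpha> w - 1) v = 1 - w \<noteq> 0\<close> determines \<open>v\<close>.\<close>

lemma reduced_unique:
  assumes r: "reduced \<alpha> \<beta> u v" and r': "reduced \<alpha> \<beta> u' v'" and ad: "admissible \<alpha> \<beta>"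
  shows "u = u' \<and> v = v'"
proof -
  define w w' where "w = u + v" and "w' = u' + v'"
  have w: "w > 0" "w' > 0" using r r' by (auto simp: reduced_def w_def w'_def)
  have F: "\<alpha> * \<beta> * w ^ 3 - (1 + \<alpha> + \<beta>) * w + 2 = 0" "\<alpha> * \<beta> * w' ^ 3 - (1 + \<alpha> + \<beta>) * w' + 2 = 0"
    using reduced_cubic[OF r] reduced_cubic[OF r'] by (simp_all add: w_def w'_def)
  have "w = w'"
  proof (rule ccontr)
    assume ne: "w \<noteq> w'"
    have "(w - w') * (\<alpha> * \<beta> * (w * w' * (w + w')) - 2) =
        w' * (\<alpha> * \<beta> * w ^ 3 - (1 + \<alpha> + \<beta>) * w + 2) - w * (\<alpha> * \<beta> * w' ^ 3 - (1 + \<alpha> + \<beta>) * w' + 2)"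
      by (simp add: algebra_simps power3_eq_cube)
    then have two: "\<alpha> * \<beta> * (w * w' * (w + w')) = 2" using F ne by simp
    have ppos: "w * w' * (w + w') > 0" using w by simp
    have ab: "\<alpha> * \<beta> > 0" using two ppos by (metis zero_less_mult_pos2 zero_less_numeral)
    define lo hi where "lo = min w w'" and "hi = max w w'"
    have lh: "0 < lo" "lo \<le> hi" "w * w' * (w + w') = lo * hi * (lo + hi)"
      using w by (auto simp: lo_def hi_def min_def max_def algebra_simps)
    have up: "lo * hi * (lo + hi) \<le> 2 * hi ^ 3"
    proof -
      have "lo * hi * (lo + hi) \<le> hi * hi * (hi + hi)"
        using lh by (intro mult_mono) auto
      then show ?thesis by (simp add: power3_eq_cube)
    qed
    have low: "2 * lo ^ 3 \<le> lo * hi * (lo + hi)"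
    proof -
      have "lo * lo * (lo + lo) \<le> lo * hi * (lo + hi)"
        using lh by (intro mult_mono) auto
      then show ?thesis by (simp add: power3_eq_cube)
    qed
    have up': "2 \<le> 2 * (\<alpha> * \<beta> * hi ^ 3)" and low': "2 * (\<alpha> * \<beta> * lo ^ 3) \<le> 2"
      using mult_left_mono[OF up, of "\<alpha> * \<beta>"] mult_left_mono[OF low, of "\<alpha> * \<beta>"] ab two lh(3)
      by (simp_all add: mult.assoc mult.left_commute)
    have pos: "\<alpha> > 0" "\<beta> > 0"
      using ad ab by (auto simp: admissible_def zero_less_mult_iff)
    have s: "(\<alpha> < 1 \<and> \<beta> < 1 \<longrightarrow> \<alpha> * \<beta> * hi ^ 3 < 1) \<and> (\<alpha> > 1 \<and> \<beta> > 1 \<longrightarrow> \<alpha> * \<beta> * lo ^ 3 > 1)"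
      using reduced_cubic_slope[OF r pos] reduced_cubic_slope[OF r' pos]
      by (auto simp: w_def w'_def lo_def hi_def min_def max_def)
    then show False using ad pos up' low' by (auto simp: admissible_def)
  qed
  have e: "(\<alpha> * w - 1) * v = 1 - w" "(\<alpha> * w' - 1) * v' = 1 - w'"
    using r r' by (simp_all add: reduced_def w_def w'_def algebra_simps)
  have "w \<noteq> 1" using reduced_sum_ne_1[OF r ad] by (simp add: w_def)
  then have "\<alpha> * w - 1 \<noteq> 0" using e by auto
  then have "v = v'" using e \<open>w = w'\<close> by (metis mult_left_cancel)
  then show ?thesis using \<open>w = w'\<close> by (simp add: w_def w'_def)
qed

lemma continuous_root:
  fixes f :: "real \<Rightarrow> real"
  assumes "continuous_on UNIV f" "l < h" "f l * f h < 0"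
  obtains x where "l < x" "x < h" "f x = 0"
proof -
  have c: "continuous_on {l..h} f" using assms(1) continuous_on_subset by blast
  have "\<exists>x\<ge>l. x \<le> h \<and> f x = 0"
    using assms(2,3) IVT'[of f l 0 h] IVT2'[of f h 0 l] c
    by (auto simp: mult_less_0_iff)
  then obtain x where x: "l \<le> x" "x \<le> h" "f x = 0" by blast
  moreover have "x \<noteq> l" "x \<noteq> h" using x(3) assms(3) by auto
  ultimately show ?thesis using that by force
qed

text \<open>Solving the equations for \<open>u\<close> and \<open>v\<close> with \<open>u + v\<close> fixed to be \<open>w\<close>; the cubic is the
  condition that the values found indeed add up to \<open>w\<close>.\<close>

lemma reduced_of_root:
  fixes \<alpha> \<beta> w :: real
  assumes F: "\<alpha> * \<beta> * w ^ 3 - (1 + \<alpha> + \<beta>) * w + 2 = 0" and ne: "\<alpha> * w \<noteq> 1" "\<beta> * w \<noteq> 1"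
  defines "u \<equiv> (1 - w) / (\<beta> * w - 1)" and "v \<equiv> (1 - w) / (\<alpha> * w - 1)"
  shows "u + v = w" "1 - u = \<alpha> * v * (u + v)" "1 - v = \<beta> * u * (u + v)"
proof -
  have nz: "\<alpha> * w - 1 \<noteq> 0" "\<beta> * w - 1 \<noteq> 0" using ne by auto
  have e: "v * (\<alpha> * w - 1) = 1 - w" "u * (\<beta> * w - 1) = 1 - w"
    using nz by (simp_all add: u_def v_def)
  have "(\<alpha> * w - 1) * (\<beta> * w - 1) * (u + v - w) =
      (\<alpha> * w - 1) * (u * (\<beta> * w - 1)) + (\<beta> * w - 1) * (v * (\<alpha> * w - 1)) - w * ((\<alpha> * w - 1) * (\<beta> * w - 1))"
    by (simp add: algebra_simps)
  also have "\<dots> = (\<alpha> * w - 1) * (1 - w) + (\<beta> * w - 1) * (1 - w) - w * ((\<alpha> * w - 1) * (\<beta> * w - 1))"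
    by (simp only: e)
  also have "\<dots> = - (\<alpha> * \<beta> * w ^ 3 - (1 + \<alpha> + \<beta>) * w + 2)"
    by (simp add: algebra_simps power3_eq_cube)
  finally show s: "u + v = w" using F nz by simp
  show "1 - u = \<alpha> * v * (u + v)" "1 - v = \<beta> * u * (u + v)"
    using e s by (simp_all add: algebra_simps)
qed

text \<open>The bounds on the root are those that make the values of \<open>reduced_of_root\<close> have the right signs.
  The cubic changes sign between 1 and \<open>1 / \<alpha>\<close> or \<open>1 / \<beta>\<close>. For \<open>\<alpha> = \<beta>\<close> it vanishes at
  \<open>1 / \<alpha>\<close>, and the intermediate value theorem is applied to the quadratic factor \<open>G\<close> that
  remains.\<close>

lemma reduced_root_exists:
  assumes \<alpha>: "\<alpha> > 0" and \<beta>: "\<beta> \<le> \<alpha>" and ad: "admissible \<alpha> \<beta>"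
  obtains w where "\<alpha> * \<beta> * w ^ 3 - (1 + \<alpha> + \<beta>) * w + 2 = 0" "w > 0"
    "\<alpha> < 1 \<longrightarrow> w > 1 \<and> \<alpha> * w < 1 \<and> \<beta> * w < 1"
    "\<alpha> > 1 \<longrightarrow> w < 1 \<and> \<alpha> * w > 1 \<and> (\<beta> > 0 \<longrightarrow> \<beta> * w > 1)"
proof -
  define F where "F = (\<lambda>w. \<alpha> * \<beta> * w ^ 3 - (1 + \<alpha> + \<beta>) * w + 2)"
  define G where "G = (\<lambda>w. \<alpha> * w\<^sup>2 + w - 2)"
  have cont: "continuous_on UNIV F" "continuous_on UNIV G"
    unfolding F_def G_def by (intro continuous_intros)+
  have F1: "F 1 = (1 - \<alpha>) * (1 - \<beta>)" by (simp add: F_def algebra_simps)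
  have G1: "G 1 = \<alpha> - 1" "G (1 / \<alpha>) = 2 * (1 - \<alpha>) / \<alpha>"
    using \<alpha> by (simp_all add: G_def field_simps power2_eq_square)
  have Fa: "F (1 / \<alpha>) = (\<alpha> - \<beta>) * (\<alpha> - 1) / \<alpha>\<^sup>2"
    using \<alpha> by (simp add: F_def field_simps power2_eq_square power3_eq_cube)
  have Fb: "F (1 / \<beta>) = (\<beta> - \<alpha>) * (\<beta> - 1) / \<beta>\<^sup>2" if "\<beta> > 0"
    using that by (simp add: F_def field_simps power2_eq_square power3_eq_cube)
  have FG: "F w = (\<alpha> * w - 1) * G w" if "\<beta> = \<alpha>" for w
    by (simp add: F_def G_def that algebra_simps power2_eq_square power3_eq_cube)
  consider "\<beta> < 0" "\<alpha> > 1" | "0 < \<beta>" "\<beta> < \<alpha>" "\<alpha> < 1" | "\<beta> = \<alpha>" "\<alpha> < 1"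
    | "1 < \<beta>" "\<beta> < \<alpha>" | "\<beta> = \<alpha>" "\<alpha> > 1"
    using assms by (fastforce simp: admissible_def)
  then show ?thesis
  proof cases
    case 1
    have "F (1 / \<alpha>) > 0" "F 1 < 0" using 1 by (simp_all add: Fa F1 mult_less_0_iff)
    then obtain w where "1 / \<alpha> < w" "w < 1" "F w = 0"
      using continuous_root[OF cont(1), of "1 / \<alpha>" 1] 1 by (auto simp: mult_less_0_iff)
    moreover have "w > 0" using calculation \<alpha> by (smt (verit) divide_pos_pos)
    ultimately show ?thesis using that[of w] 1 by (simp add: F_def field_simps)
  next
    case 2
    have "F 1 > 0" "F (1 / \<alpha>) < 0"
      using 2 by (simp_all add: Fa F1 mult_less_0_iff divide_less_0_iff)
    then obtain w where w: "1 < w" "w < 1 / \<alpha>" "F w = 0"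
      using continuous_root[OF cont(1), of 1 "1 / \<alpha>"] 2 by (auto simp: mult_less_0_iff)
    moreover have "\<alpha> * w < 1" using w 2 by (simp add: field_simps)
    moreover have "\<beta> * w < \<alpha> * w" using w 2 by simp
    moreover have "\<beta> * w < 1" using calculation by linarith
    ultimately show ?thesis using that[of w] 2 by (simp add: F_def)
  next
    case 3
    have "G 1 < 0" "G (1 / \<alpha>) > 0" using 3 \<alpha> by (simp_all add: G1)
    then obtain w where w: "1 < w" "w < 1 / \<alpha>" "G w = 0"
      using continuous_root[OF cont(2), of 1 "1 / \<alpha>"] 3 \<alpha> by (auto simp: mult_less_0_iff)
    have "F w = 0" using FG 3 w by simp
    moreover have "\<alpha> * w < 1" using w \<alpha> by (simp add: field_simps)
    ultimately show ?thesis using that[of w] 3 w by (simp add: F_def)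
  next
    case 4
    have "F (1 / \<beta>) < 0" "F 1 > 0"
      using 4 by (simp_all add: Fb F1 mult_less_0_iff zero_less_mult_iff divide_less_0_iff)
    then obtain w where w: "1 / \<beta> < w" "w < 1" "F w = 0"
      using continuous_root[OF cont(1), of "1 / \<beta>" 1] 4 by (auto simp: mult_less_0_iff)
    have w0: "w > 0" using w 4 by (smt (verit) divide_pos_pos)
    have "\<beta> * w > 1" using w 4 by (simp add: field_simps)
    moreover have "\<alpha> * w > \<beta> * w" using w0 4 by simp
    moreover have "\<alpha> * w > 1" using calculation by linarith
    ultimately show ?thesis using that[of w] 4 w w0 by (simp add: F_def)
  next
    case 5
    have "G 1 > 0" "G (1 / \<alpha>) < 0" using 5 \<alpha> by (simp_all add: G1 divide_less_0_iff)
    then obtain w where w: "1 / \<alpha> < w" "w < 1" "G w = 0"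
      using continuous_root[OF cont(2), of "1 / \<alpha>" 1] 5 by (auto simp: mult_less_0_iff)
    have w0: "w > 0" using w \<alpha> by (smt (verit) divide_pos_pos)
    have "F w = 0" using FG 5 w by simp
    moreover have "\<alpha> * w > 1" using w \<alpha> by (simp add: field_simps)
    ultimately show ?thesis using that[of w] 5 w w0 by (simp add: F_def)
  qed
qed

lemma reduced_exists_le:
  assumes \<alpha>: "\<alpha> > 0" and \<beta>: "\<beta> \<le> \<alpha>" and ad: "admissible \<alpha> \<beta>"
  shows "\<exists>u v. reduced \<alpha> \<beta> u v"
proof -
  obtain w where F: "\<alpha> * \<beta> * w ^ 3 - (1 + \<alpha> + \<beta>) * w + 2 = 0" and w0: "w > 0"
    and lt: "\<alpha> < 1 \<longrightarrow> w > 1 \<and> \<alpha> * w < 1 \<and> \<beta> * w < 1"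
    and gt: "\<alpha> > 1 \<longrightarrow> w < 1 \<and> \<alpha> * w > 1 \<and> (\<beta> > 0 \<longrightarrow> \<beta> * w > 1)"
    using reduced_root_exists[OF assms] by blast
  define u v where "u = (1 - w) / (\<beta> * w - 1)" and "v = (1 - w) / (\<alpha> * w - 1)"
  have \<beta>neg: "\<beta> * w < 0" "\<alpha> > 1" if "\<beta> < 0"
    using that w0 ad by (auto simp: mult_less_0_iff admissible_def)
  have \<beta>pos: "\<alpha> < 1 \<or> \<alpha> > 1" "\<beta> > 0" if "\<not> \<beta> < 0"
    using that ad \<alpha> by (auto simp: admissible_def)
  have ne: "\<alpha> * w \<noteq> 1" "\<beta> * w \<noteq> 1"
    using \<beta>neg \<beta>pos lt gt by (cases "\<beta> < 0"; force)+
  note s = reduced_of_root[OF F ne, folded u_def v_def]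
  have "\<alpha> < 1 \<or> \<alpha> > 1" using \<beta>neg \<beta>pos by blast
  then have "v > 0"
    using lt gt by (auto simp: v_def zero_less_divide_iff)
  then have "1 - u > 0" unfolding s(2) using \<alpha> w0 s(1) by simp
  moreover have "\<beta> * u > 0"
  proof (cases "\<beta> < 0")
    case True
    then have "u < 0" using \<beta>neg gt by (simp add: u_def divide_less_0_iff)
    then show ?thesis using True by (simp add: mult_neg_neg)
  next
    case False
    then have "u > 0" using \<beta>pos lt gt by (auto simp: u_def zero_less_divide_iff)
    then show ?thesis using \<beta>pos False by simp
  qed
  then have "1 - v > 0" unfolding s(3) using w0 s(1) by simp
  ultimately show ?thesis using s w0 unfolding reduced_def by (intro exI[of _ u] exI[of _ v]) auto
qed

lemma reduced_exists:
  assumes "admissible \<alpha> \<beta>"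
  shows "\<exists>u v. reduced \<alpha> \<beta> u v"
proof (cases "\<beta> \<le> \<alpha>")
  case True
  then show ?thesis using reduced_exists_le assms by (auto simp: admissible_def)
next
  case False
  then have "\<exists>u v. reduced \<beta> \<alpha> u v"
    using reduced_exists_le[of \<beta> \<alpha>] assms by (auto simp: admissible_def)
  then show ?thesis using reduced_swap by blast
qed

lemma prescribes_imp_reduced:
  assumes P: "prescribes T1 T2 T3 a b d c" and T3: "T3 \<noteq> 0"
  shows "reduced (- T1 / T3) (- T2 / T3) ((b + d - a) / (a + b + d)) ((a + d - b) / (a + b + d))"
proof -
  have pos: "a > 0" "b > 0" "d > 0" "c > 0"
    and r: "ricci1 a b d = c * T1" "ricci1 b a d = c * T2" "ricci3 a b d = c * T3"
    using P by (auto simp: prescribes_def)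
  define S where "S = a + b + d"
  define p q where "p = d - a + b" and "q = d + a - b"
  have S: "S > 0" using pos by (simp add: S_def)
  have r3: "ricci3 a b d = 2 * p * q / (a * b)" by (simp add: ricci3_def p_def q_def)
  have r1: "ricci1 a b d = - (2 * p * S / (b * d))" "ricci1 b a d = - (2 * q * S / (a * d))"
    using pos by (simp_all add: ricci1_def p_def q_def S_def field_simps)
  have "ricci3 a b d \<noteq> 0" using r pos T3 by simp
  then have pq: "p \<noteq> 0" "q \<noteq> 0" unfolding r3 by auto
  have "- T1 / T3 = - ricci1 a b d / ricci3 a b d" using r pos T3 by simp
  also have "\<dots> = S * a / (d * q)" unfolding r1 r3 using pos pq S by (simp add: field_simps)
  finally have \<alpha>: "- T1 / T3 = S * a / (d * q)" .
  have "- T2 / T3 = - ricci1 b a d / ricci3 a b d" using r pos T3 by simp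
  also have "\<dots> = S * b / (d * p)" unfolding r1 r3 using pos pq S by (simp add: field_simps)
  finally have \<beta>: "- T2 / T3 = S * b / (d * p)" .
  have uv: "(b + d - a) / (a + b + d) = p / S" "(a + d - b) / (a + b + d) = q / S"
    by (simp_all add: p_def q_def S_def algebra_simps)
  have sums: "S - p = 2 * a" "S - q = 2 * b" "p + q = 2 * d"
    by (simp_all add: p_def q_def S_def)
  have w: "p / S + q / S = 2 * d / S" by (simp add: sums add_divide_distrib[symmetric])
  have c: "1 - p / S = 2 * a / S" "1 - q / S = 2 * b / S"
    using S sums by (simp_all add: field_simps)
  have "p / S < 1" "q / S < 1"
    using c S pos by (smt (verit) divide_pos_pos)+
  then show ?thesis unfolding reduced_def \<alpha> \<beta> uv w c
    using pos S pq by (simp add: field_simps)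
qed

text \<open>The metric is normalised by \<open>a + b + d = 1\<close>. The product of the two equations shows that
  \<open>\<alpha> \<beta>\<close> and \<open>u v\<close> have the same sign, so the assumption is what makes \<open>c\<close> positive.\<close>

lemma reduced_imp_prescribes:
  assumes r: "reduced \<alpha> \<beta> u v" and T3: "T3 * (\<alpha> * \<beta>) > 0"
  shows "prescribes (- \<alpha> * T3) (- \<beta> * T3) T3 ((1 - u) / 2) ((1 - v) / 2) ((u + v) / 2)
    (8 * u * v / ((1 - u) * (1 - v)) / T3)"
proof -
  define w where "w = u + v"
  have lt: "1 - u > 0" "1 - v > 0" "w > 0" and e: "1 - u = \<alpha> * v * w" "1 - v = \<beta> * u * w"
    using r by (simp_all add: reduced_def w_def)
  have nz: "T3 \<noteq> 0" "\<alpha> \<noteq> 0" "\<beta> \<noteq> 0" "u \<noteq> 0" "v \<noteq> 0" "1 - u \<noteq> 0" "1 - v \<noteq> 0" "w \<noteq> 0"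
    using T3 e lt by auto
  have "8 * u * v / ((1 - u) * (1 - v)) / T3 = 8 * w\<^sup>2 * (u * v)\<^sup>2 / ((1 - u) * (1 - v))\<^sup>2 * (\<alpha> * \<beta>) / T3"
  proof -
    have "(1 - u) * (1 - v) = \<alpha> * \<beta> * (u * v) * w\<^sup>2"
      by (simp add: e power2_eq_square)
    then show ?thesis
      using nz by (simp add: power2_eq_square field_simps)
  qed
  moreover have "8 * w\<^sup>2 * (u * v)\<^sup>2 / ((1 - u) * (1 - v))\<^sup>2 > 0"
    using nz by simp
  moreover have "(\<alpha> * \<beta>) / T3 > 0"
    using T3 by (auto simp: zero_less_mult_iff zero_less_divide_iff)
  ultimately have c: "8 * u * v / ((1 - u) * (1 - v)) / T3 > 0"
    by (metis mult_pos_pos times_divide_eq_right)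
  define X where "X = (1 - u) * (1 - v)"
  have X: "X \<noteq> 0" using nz by (simp add: X_def)
  have "ricci1 ((1 - u) / 2) ((1 - v) / 2) (w / 2) = - 8 * u / ((1 - v) * w)"
    using nz by (simp add: ricci1_def w_def field_simps)
  also have "\<dots> = - 8 * u * (1 - u) / (X * w)"
    using nz by (simp add: X_def)
  also have "\<dots> = 8 * u * v / X / T3 * (- \<alpha> * T3)"
    unfolding e(1) using nz X by (simp add: field_simps)
  finally have 1: "ricci1 ((1 - u) / 2) ((1 - v) / 2) (w / 2) = 8 * u * v / X / T3 * (- \<alpha> * T3)" .
  have "ricci1 ((1 - v) / 2) ((1 - u) / 2) (w / 2) = - 8 * v / ((1 - u) * w)"
    using nz by (simp add: ricci1_def w_def field_simps)
  also have "\<dots> = - 8 * v * (1 - v) / (X * w)"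
    using nz by (simp add: X_def)
  also have "\<dots> = 8 * u * v / X / T3 * (- \<beta> * T3)"
    unfolding e(2) using nz X by (simp add: field_simps)
  finally have 2: "ricci1 ((1 - v) / 2) ((1 - u) / 2) (w / 2) = 8 * u * v / X / T3 * (- \<beta> * T3)" .
  have 3: "ricci3 ((1 - u) / 2) ((1 - v) / 2) (w / 2) = 8 * u * v / ((1 - u) * (1 - v))"
    using nz by (simp add: ricci3_def w_def field_simps)
  show ?thesis unfolding prescribes_def w_def[symmetric] X_def[symmetric]
    using 1 2 3[folded X_def] c[folded X_def] lt nz by simp
qed

lemma cases_i_to_iv_admissible:
  assumes "cases_i_to_iv T1 T2 T3"
  shows "admissible (- T1 / T3) (- T2 / T3)" "T3 \<noteq> 0" "T3 * ((- T1 / T3) * (- T2 / T3)) > 0"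
proof -
  have c: "(T3 < 0 \<and> T1 > - T3 \<and> T2 < 0) \<or> (T3 < 0 \<and> T2 > - T3 \<and> T1 < 0) \<or>
    (T3 > 0 \<and> T1 < 0 \<and> T2 < 0 \<and> (- T1 < T3 \<and> - T2 < T3 \<or> - T1 > T3 \<and> - T2 > T3))"
    using assms by (auto simp: cases_i_to_iv_def)
  then show "T3 \<noteq> 0" by auto
  show "admissible (- T1 / T3) (- T2 / T3)"
    using c unfolding admissible_def by (auto simp: field_simps)
  have "T3 * ((- T1 / T3) * (- T2 / T3)) = T1 * T2 / T3" using c by auto
  then show "T3 * ((- T1 / T3) * (- T2 / T3)) > 0"
    using c by (auto simp: zero_less_divide_iff zero_less_mult_iff mult_less_0_iff)
qed

lemma prescribes_exists:
  assumes "cases_i_to_iv T1 T2 T3"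
  shows "\<exists>a b d c. prescribes T1 T2 T3 a b d c"
proof -
  note ad = cases_i_to_iv_admissible[OF assms]
  obtain u v where "reduced (- T1 / T3) (- T2 / T3) u v" using reduced_exists[OF ad(1)] by blast
  from reduced_imp_prescribes[OF this ad(3)] show ?thesis using ad(2) by auto
qed

lemma ricci_scale:
  assumes "k \<noteq> 0"
  shows "ricci1 (k * a) (k * b) (k * d) = ricci1 a b d" "ricci3 (k * a) (k * b) (k * d) = ricci3 a b d"
proof -
  have e: "k * a - k * b - k * d = k * (a - b - d)" "k * a + k * b + k * d = k * (a + b + d)"
    "k * d - k * a + k * b = k * (d - a + b)" "k * d + k * a - k * b = k * (d + a - b)"
    by (simp_all add: algebra_simps)
  show "ricci1 (k * a) (k * b) (k * d) = ricci1 a b d" "ricci3 (k * a) (k * b) (k * d) = ricci3 a b d"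
    unfolding ricci1_def ricci3_def e using assms by simp_all
qed

text \<open>The coordinates \<open>u, v\<close> and the sum \<open>a + b + d\<close> determine the metric, and \<open>c\<close> follows from
  the third equation, whose left-hand side is invariant under scaling.\<close>

lemma prescribes_unique:
  assumes T: "cases_i_to_iv T1 T2 T3"
    and P: "prescribes T1 T2 T3 a b d c" and P': "prescribes T1 T2 T3 a' b' d' c'"
  shows "c' = c \<and> (\<exists>k>0. a' = k * a \<and> b' = k * b \<and> d' = k * d)"
proof -
  note ad = cases_i_to_iv_admissible[OF T]
  define S S' where "S = a + b + d" and "S' = a' + b' + d'"
  have S: "S > 0" "S' > 0" using P P' by (auto simp: prescribes_def S_def S'_def)
  have eq: "(b + d - a) / S = (b' + d' - a') / S'" "(a + d - b) / S = (a' + d' - b') / S'"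
    using reduced_unique[OF prescribes_imp_reduced[OF P ad(2)] prescribes_imp_reduced[OF P' ad(2)] ad(1)]
    by (simp_all add: S_def S'_def)
  define k where "k = S' / S"
  have k: "k > 0" "S' = k * S" using S by (simp_all add: k_def)
  have "y = k * x" if "x / S = y / S'" for x y
    using that S by (simp add: k_def field_simps)
  then have "b' + d' - a' = k * (b + d - a)" "a' + d' - b' = k * (a + d - b)"
    using eq S by simp_all
  then have e: "a' = k * a" "b' = k * b" "d' = k * d"
    using k(2) by (simp_all add: S_def S'_def algebra_simps)
  have "c * T3 = c' * T3"
    using P P' ricci_scale(2)[of k a b d] k(1) e by (simp add: prescribes_def)
  then show ?thesis using ad(2) e k by auto
qed

section \<open>Solutions in terms of frames\<close>

text \<open>The matrix version of \<open>sl2_basis\<close> together with \<open>diagonal_in\<close>, see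
  \<open>diagonal_frame_iff_diagonal_in\<close>; as a statement on all vectors it is stable under a change of
  frame.\<close>

definition diagonal_frame ::
  "(real ^ 3 \<Rightarrow> real ^ 3 \<Rightarrow> real) \<Rightarrow> real ^ 3 ^ 3 \<Rightarrow> real \<Rightarrow> real \<Rightarrow> real \<Rightarrow> bool" where
  "diagonal_frame f A t1 t2 t3 \<longleftrightarrow>
     lorentz_matrix A \<and> (\<forall>x y. f (A *v x) (A *v y) = diag_form t1 t2 t3 x y)"

lemma frame_matrix_vector:
  "frame_matrix V *v x = (x $ 1) *\<^sub>R V 1 + (x $ 2) *\<^sub>R V 2 + (x $ 3) *\<^sub>R V 3"
  by (simp add: vec_eq_iff forall_3 matrix_vector_mult_def sum_3 mult.commute frame_matrix_def)

lemma diag_form_axis: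
  "diag_form a b d (axis i 1) (axis j 1) =
    (if i = j then (if i = 1 then a else if i = 2 then b else d) else 0)"
  using exhaust_3[of i] exhaust_3[of j] by (auto simp: diag_form_def axis_def)

lemma diagonal_frame_iff_diagonal_in:
  assumes T: "bilinear T"
  shows "diagonal_frame T (frame_matrix V) T1 T2 T3 \<longleftrightarrow> sl2_basis V \<and> diagonal_in T V T1 T2 T3"
proof -
  have "(\<forall>x y. T (frame_matrix V *v x) (frame_matrix V *v y) = diag_form T1 T2 T3 x y) \<longleftrightarrow>
      diagonal_in T V T1 T2 T3" (is "?L \<longleftrightarrow> ?R")
  proof
    assume ?L
    then have "T (V i) (V j) = diag_form T1 T2 T3 (axis i 1) (axis j 1)" for i j
      by (metis frame_matrix_axis)
    then show ?R by (simp add: diagonal_in_def diag_form_axis)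
  next
    assume ?R
    then have "T (V 1) (V 1) = T1" "T (V 2) (V 2) = T2" "T (V 3) (V 3) = T3"
      "T (V 1) (V 2) = 0" "T (V 1) (V 3) = 0" "T (V 2) (V 1) = 0" "T (V 2) (V 3) = 0"
      "T (V 3) (V 1) = 0" "T (V 3) (V 2) = 0"
      by (simp_all add: diagonal_in_def)
    then show ?L
      by (simp add: frame_matrix_vector bilinear_ladd[OF T] bilinear_radd[OF T]
        bilinear_lmul[OF T] bilinear_rmul[OF T] diag_form_def)
  qed
  then show ?thesis by (simp add: diagonal_frame_def sl2_basis_iff_lorentz_matrix)
qed

lemma frame_matrix_columns: "frame_matrix (\<lambda>j. column j A) = A"
  by (simp add: frame_matrix_def column_def vec_eq_iff)

lemma diag_form_eqD:
  assumes "\<And>x y. diag_form a b d x y = diag_form a' b' d' x y"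
  shows "a = a'" "b = b'" "d = d'"
  using assms[of "axis 1 1" "axis 1 1"] assms[of "axis 2 1" "axis 2 1"] assms[of "axis 3 1" "axis 3 1"]
  by (simp_all add: diag_form_axis)

lemma lorentz_inverse_vector:
  assumes "lorentz_matrix A"
  shows "lorentz_inverse A *v (A *v x) = x" "A *v (lorentz_inverse A *v x) = x"
  using lorentz_matrix_inverse[OF lorentz_matrix_gram[OF assms]]
  by (simp_all add: matrix_vector_mul_assoc)

definition frame_form :: "real ^ 3 ^ 3 \<Rightarrow> real \<Rightarrow> real \<Rightarrow> real \<Rightarrow> real ^ 3 \<Rightarrow> real ^ 3 \<Rightarrow> real" where
  "frame_form A a b d = (\<lambda>x y. diag_form a b d (lorentz_inverse A *v x) (lorentz_inverse A *v y))"

lemma diagonal_frame_iff_frame_form: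
  "diagonal_frame f A a b d \<longleftrightarrow> lorentz_matrix A \<and> f = frame_form A a b d"
proof -
  have "f = frame_form A a b d" if "lorentz_matrix A" "\<forall>x y. f (A *v x) (A *v y) = diag_form a b d x y"
  proof (intro ext)
    fix x y
    show "f x y = frame_form A a b d x y"
      using that(2)[rule_format, of "lorentz_inverse A *v x" "lorentz_inverse A *v y"]
      by (simp add: frame_form_def lorentz_inverse_vector[OF that(1)])
  qed
  then show ?thesis
    by (auto simp: diagonal_frame_def frame_form_def lorentz_inverse_vector)
qed

lemma frame_form_metric:
  assumes A: "lorentz_matrix A" and "a > 0" "b > 0" "d > 0"
  shows "left_invariant_metric (frame_form A a b d)"
proof -
  have "bilinear (frame_form A a b d)"
    unfolding frame_form_def
    using bilinear_compose_linear[of "diag_form a b d" "(*v) (lorentz_inverse A)" "\<lambda>x. x"]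
    by (simp add: bilinear_diag_form linear_ident)
  moreover have "frame_form A a b d x x > 0" if "x \<noteq> 0" for x
  proof -
    have "lorentz_inverse A *v x \<noteq> 0"
      using that lorentz_inverse_vector(2)[OF A, of x] by auto
    then show ?thesis using diag_form_metric[OF assms(2-4)]
      by (simp add: frame_form_def left_invariant_metric_def)
  qed
  ultimately show ?thesis
    by (simp add: left_invariant_metric_def) (simp add: frame_form_def diag_form_def)
qed

lemma ricci_solution_iff_prescribes:
  assumes g: "diagonal_frame g A a b d" and T: "diagonal_frame T A t1 t2 t3"
  shows "(g, c) \<in> ricci_solutions T \<longleftrightarrow> prescribes t1 t2 t3 a b d c"
proof -
  have A: "lorentz_matrix A" and gA: "g (A *v x) (A *v y) = diag_form a b d x y"
    and TA: "T (A *v x) (A *v y) = diag_form t1 t2 t3 x y" for x y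
    using g T by (auto simp: diagonal_frame_def)
  have "left_invariant_metric g \<longleftrightarrow> a > 0 \<and> b > 0 \<and> d > 0"
  proof
    assume m: "left_invariant_metric g"
    have "g (A *v axis i 1) (A *v axis i 1) > 0" for i
    proof -
      have "A *v axis i 1 \<noteq> 0"
        using lorentz_inverse_vector(1)[OF A, of "axis i 1"]
        by (metis axis_eq_0_iff matrix_vector_mult_0_right zero_neq_one)
      then show ?thesis using m by (simp add: left_invariant_metric_def)
    qed
    from this[of 1] this[of 2] this[of 3] show "a > 0 \<and> b > 0 \<and> d > 0"
      by (simp add: gA diag_form_axis)
  qed (use g frame_form_metric in \<open>auto simp: diagonal_frame_iff_frame_form\<close>)
  moreover have "(\<forall>x y. Ric g x y = c * T x y) \<longleftrightarrow>
      ricci1 a b d = c * t1 \<and> ricci1 b a d = c * t2 \<and> ricci3 a b d = c * t3" (is "?L \<longleftrightarrow> ?R")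
    if "a > 0" "b > 0" "d > 0"
  proof -
    have m: "left_invariant_metric g"
      using g frame_form_metric that by (auto simp: diagonal_frame_iff_frame_form)
    note R = Ric_diagonal_frame[OF A that m gA]
    have cT: "c * T (A *v x) (A *v y) = diag_form (c * t1) (c * t2) (c * t3) x y" for x y
      by (simp add: TA diag_form_def algebra_simps)
    show ?thesis
    proof
      assume ?L
      then have "diag_form (ricci1 a b d) (ricci1 b a d) (ricci3 a b d) x y =
          diag_form (c * t1) (c * t2) (c * t3) x y" for x y
        unfolding R[symmetric] cT[symmetric] by blast
      then show ?R using diag_form_eqD by blast
    next
      assume ?R
      then have "Ric g (A *v x) (A *v y) = c * T (A *v x) (A *v y)" for x y
        unfolding R cT by simp
      then show ?L by (metis lorentz_inverse_vector(2)[OF A])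
    qed
  qed
  ultimately show ?thesis by (auto simp: ricci_solutions_def prescribes_def)
qed

lemma ricci_solution_frame:
  assumes s: "(g, c) \<in> ricci_solutions T"
  obtains A a b d t1 t2 t3 where "diagonal_frame g A a b d" "diagonal_frame T A t1 t2 t3"
    "prescribes t1 t2 t3 a b d c"
proof -
  have m: "left_invariant_metric g" and c: "c > 0" and R: "Ric g x y = c * T x y" for x y
    using s by (auto simp: ricci_solutions_def)
  obtain A a b d where A: "lorentz_matrix A" and pos: "a > 0" "b > 0" "d > 0"
    and gA: "\<And>x y. g (A *v x) (A *v y) = diag_form a b d x y"
    using milnor_frame[OF m] by blast
  have "T (A *v x) (A *v y) = diag_form (ricci1 a b d / c) (ricci1 b a d / c) (ricci3 a b d / c) x y" for x y
  proof -
    have "c * T (A *v x) (A *v y) = diag_form (ricci1 a b d) (ricci1 b a d) (ricci3 a b d) x y"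
      using Ric_diagonal_frame[OF A pos m gA] R by metis
    then show ?thesis using c by (simp add: diag_form_def field_simps)
  qed
  then have T: "diagonal_frame T A (ricci1 a b d / c) (ricci1 b a d / c) (ricci3 a b d / c)"
    using A by (simp add: diagonal_frame_def)
  have g: "diagonal_frame g A a b d" using A gA by (simp add: diagonal_frame_def)
  show ?thesis using that[OF g T] s ricci_solution_iff_prescribes[OF g T] by blast
qed

lemma prescribes_cases:
  assumes "prescribes t1 t2 t3 a b d c"
  shows "cases_i_to_iv t1 t2 t3 \<or> cases_v_to_vii t1 t2 t3"
  using ricci_classification[of a b d] assms cases_scale[of c t1 t2 t3]
  by (auto simp: prescribes_def)

section \<open>Two frames that diagonalise the same tensor\<close>

text \<open>The Gram matrix of \<open>diag_form\<close>, for which a change of frame is a product of matrices.\<close>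

definition diag_matrix :: "real \<Rightarrow> real \<Rightarrow> real \<Rightarrow> real ^ 3 ^ 3" where
  "diag_matrix a b d = (\<chi> i j. diag_form a b d (axis i 1) (axis j 1))"

lemma diag_matrix_nth [simp]:
  "diag_matrix a b d $ 1 $ 1 = a" "diag_matrix a b d $ 1 $ 2 = 0" "diag_matrix a b d $ 1 $ 3 = 0"
  "diag_matrix a b d $ 2 $ 1 = 0" "diag_matrix a b d $ 2 $ 2 = b" "diag_matrix a b d $ 2 $ 3 = 0"
  "diag_matrix a b d $ 3 $ 1 = 0" "diag_matrix a b d $ 3 $ 2 = 0" "diag_matrix a b d $ 3 $ 3 = d"
  by (simp_all add: diag_matrix_def diag_form_axis)

lemma diag_matrix_gram:
  "transpose Q ** diag_matrix a b d ** Q =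
    (\<chi> i j. diag_form a b d (Q *v axis i 1) (Q *v axis j 1))"
  by (simp add: mat3_eq_iff matrix_matrix_mult_def sum_3 transpose_def diag_form_def
      matrix_vector_mult_basis column_def algebra_simps)

text \<open>From \<open>Q\<^sup>T D Q = D'\<close> and \<open>Q J Q\<^sup>T = J\<close> follows \<open>Q J D' = J D Q\<close>, so \<open>Q\<close> intertwines two
  diagonal matrices. Read entrywise, an entry of \<open>Q\<close> can be nonzero only if the corresponding
  eigenvalues of \<open>J D\<close> and \<open>J D'\<close> agree.\<close>

lemma frame_transition:
  assumes T: "diagonal_frame T A t1 t2 t3" and T': "diagonal_frame T A' t1' t2' t3'"
  obtains Q where "A' = A ** Q" "transpose Q ** lorentz ** Q = lorentz"
    "Q ** lorentz ** transpose Q = lorentz"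
    "Q $ 1 $ 1 * t1' = t1 * Q $ 1 $ 1" "Q $ 1 $ 2 * t2' = t1 * Q $ 1 $ 2"
    "Q $ 2 $ 1 * t1' = t2 * Q $ 2 $ 1" "Q $ 2 $ 2 * t2' = t2 * Q $ 2 $ 2"
    "(t1 + t3') * Q $ 1 $ 3 = 0" "(t2 + t3') * Q $ 2 $ 3 = 0"
    "Q $ 3 $ 3 * t3' = t3 * Q $ 3 $ 3"
proof -
  define B where "B = lorentz_inverse A"
  define Q where "Q = B ** A'"
  have A: "lorentz_matrix A" and A': "lorentz_matrix A'"
    using T T' by (auto simp: diagonal_frame_def)
  note gA = lorentz_matrix_gram[OF A] and gA' = lorentz_matrix_gram[OF A']
  have AB: "A ** B = mat 1" using lorentz_matrix_inverse[OF gA] by (simp add: B_def)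
  have A'Q: "A' = A ** Q" by (simp add: Q_def matrix_mul_assoc AB)
  have "transpose Q ** (transpose A ** lorentz ** A) ** Q = lorentz"
    using gA' unfolding A'Q by (simp add: matrix_transpose_mul matrix_mul_assoc)
  then have gQ: "transpose Q ** lorentz ** Q = lorentz" unfolding gA .
  have "Q ** lorentz ** transpose Q ** (lorentz ** lorentz) = lorentz"
  proof -
    have "Q ** lorentz ** transpose Q ** (lorentz ** lorentz) = Q ** lorentz_inverse Q ** lorentz"
      by (simp add: lorentz_inverse_def matrix_mul_assoc)
    then show ?thesis by (simp add: lorentz_matrix_inverse[OF gQ])
  qed
  then have gQ': "Q ** lorentz ** transpose Q = lorentz" by (simp add: lorentz_squared)
  have "diag_form t1 t2 t3 (Q *v x) (Q *v y) = diag_form t1' t2' t3' x y" for x y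
    using T T' unfolding diagonal_frame_def A'Q matrix_vector_mul_assoc[symmetric] by metis
  then have D: "transpose Q ** diag_matrix t1 t2 t3 ** Q = diag_matrix t1' t2' t3'"
    unfolding diag_matrix_gram by (simp add: diag_matrix_def)
  have "Q ** lorentz ** diag_matrix t1' t2' t3' = lorentz ** diag_matrix t1 t2 t3 ** Q"
    unfolding D[symmetric] using gQ' by (simp add: matrix_mul_assoc)
  then have e: "Q $ 1 $ 1 * t1' = t1 * Q $ 1 $ 1" "Q $ 1 $ 2 * t2' = t1 * Q $ 1 $ 2"
    "Q $ 2 $ 1 * t1' = t2 * Q $ 2 $ 1" "Q $ 2 $ 2 * t2' = t2 * Q $ 2 $ 2"
    "- (Q $ 1 $ 3 * t3') = t1 * Q $ 1 $ 3" "- (Q $ 2 $ 3 * t3') = t2 * Q $ 2 $ 3"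
    "Q $ 3 $ 3 * t3' = t3 * Q $ 3 $ 3"
    by (simp_all add: mat3_eq_iff matrix_matrix_mult_def sum_3)
  have "(t1 + t3') * Q $ 1 $ 3 = 0" "(t2 + t3') * Q $ 2 $ 3 = 0"
    using e(5,6) by (simp_all add: distrib_right mult.commute)
  then show ?thesis
    using that[OF A'Q gQ gQ'] e by blast
qed

text \<open>The columns of a Lorentz matrix are unit vectors of the Lorentz form. A timelike column has a
  nonzero timelike component and a spacelike one has a nonzero spacelike component, so the
  timelike eigenvalue stays and a spacelike eigenvalue in one frame is one in the other.\<close>

lemma frame_coefficients:
  assumes T: "diagonal_frame T A t1 t2 t3" and T': "diagonal_frame T A' t1' t2' t3'"
  shows "t3' = t3" "t1' = t1 \<or> t1' = t2" "t2' = t1 \<or> t2' = t2"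
proof -
  obtain Q where Q: "A' = A ** Q" "transpose Q ** lorentz ** Q = lorentz"
    "Q ** lorentz ** transpose Q = lorentz"
    "Q $ 1 $ 1 * t1' = t1 * Q $ 1 $ 1" "Q $ 1 $ 2 * t2' = t1 * Q $ 1 $ 2"
    "Q $ 2 $ 1 * t1' = t2 * Q $ 2 $ 1" "Q $ 2 $ 2 * t2' = t2 * Q $ 2 $ 2"
    "(t1 + t3') * Q $ 1 $ 3 = 0" "(t2 + t3') * Q $ 2 $ 3 = 0"
    "Q $ 3 $ 3 * t3' = t3 * Q $ 3 $ 3"
    using frame_transition[OF T T'] by metis
  have c: "(Q$1$1)\<^sup>2 + (Q$2$1)\<^sup>2 = 1 + (Q$3$1)\<^sup>2" "(Q$1$2)\<^sup>2 + (Q$2$2)\<^sup>2 = 1 + (Q$3$2)\<^sup>2"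
    "(Q$3$3)\<^sup>2 = 1 + (Q$1$3)\<^sup>2 + (Q$2$3)\<^sup>2"
    using Q(2) by (simp_all add: mat3_eq_iff matrix_matrix_mult_def sum_3 transpose_def power2_eq_square)
  have pos: "1 + r\<^sup>2 > 0" for r :: real
    by (smt (verit) zero_le_power2)
  have "Q$3$3 \<noteq> 0" using c(3) pos[of "Q$1$3"] by (smt (verit) zero_le_power2 zero_power2)
  then show "t3' = t3" using Q by simp
  have "Q$1$1 \<noteq> 0 \<or> Q$2$1 \<noteq> 0" using c(1) pos[of "Q$3$1"] by (smt (verit) zero_power2)
  then show "t1' = t1 \<or> t1' = t2" using Q by auto
  have "Q$1$2 \<noteq> 0 \<or> Q$2$2 \<noteq> 0" using c(2) pos[of "Q$3$2"] by (smt (verit) zero_power2)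
  then show "t2' = t1 \<or> t2' = t2" using Q by auto
qed

text \<open>The difference of the first two curvatures is a multiple of \<open>(a - b) (a + b - d)\<close>, and the second
  factor vanishes only when the first curvature is the negative of the third.\<close>

lemma prescribes_equal_coefficients:
  assumes P: "prescribes t1 t2 t3 a b d c" and t: "t1 = t2" "t1 \<noteq> - t3"
  shows "a = b"
proof -
  have pos: "a > 0" "b > 0" "d > 0" "c > 0"
    and r: "ricci1 a b d = c * t1" "ricci1 b a d = c * t1" "ricci3 a b d = c * t3"
    using P t by (auto simp: prescribes_def)
  have "ricci1 a b d - ricci1 b a d = 2 * (a + b + d) * ((a - b) * (a + b - d)) / (a * b * d)"
    using pos by (simp add: ricci1_def field_simps)
  then have "(a - b) * (a + b - d) = 0" using r pos by simp
  moreover have "a + b - d \<noteq> 0"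
  proof
    assume "a + b - d = 0"
    then have "c * (t1 + t3) = 0"
      using ricci_sums(1)[of a b d] r pos by (simp add: algebra_simps)
    then show False using pos t by simp
  qed
  ultimately show ?thesis by simp
qed

text \<open>The third column of \<open>Q\<close> is forced to be \<open>\<plusminus>\<close> the third axis, and then so is the third row; the
  remaining block is orthogonal. If \<open>t1 \<noteq> t2\<close>, it is a permutation with signs. If \<open>t1 = t2\<close>, it
  may be any rotation, but then the solution has \<open>a = b\<close> and is invariant under it. Either way the
  mixed term of \<open>g\<close> in the given frame vanishes.\<close>

lemma solution_diagonal_in_frame:
  assumes T: "diagonal_frame T A t1 t2 t3" and t: "t1 \<noteq> - t3" "t2 \<noteq> - t3"
    and s: "(g, c) \<in> ricci_solutions T"
  obtains a b d where "diagonal_frame g A a b d"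
proof -
  obtain A' a b d t1' t2' t3' where g: "diagonal_frame g A' a b d"
    and T': "diagonal_frame T A' t1' t2' t3'" and P: "prescribes t1' t2' t3' a b d c"
    using ricci_solution_frame[OF s] by blast
  obtain Q where Q: "A' = A ** Q" "transpose Q ** lorentz ** Q = lorentz"
    "Q ** lorentz ** transpose Q = lorentz"
    "Q $ 1 $ 1 * t1' = t1 * Q $ 1 $ 1" "Q $ 1 $ 2 * t2' = t1 * Q $ 1 $ 2"
    "Q $ 2 $ 1 * t1' = t2 * Q $ 2 $ 1" "Q $ 2 $ 2 * t2' = t2 * Q $ 2 $ 2"
    "(t1 + t3') * Q $ 1 $ 3 = 0" "(t2 + t3') * Q $ 2 $ 3 = 0"
    "Q $ 3 $ 3 * t3' = t3 * Q $ 3 $ 3"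
    using frame_transition[OF T T'] by metis
  note fc = frame_coefficients[OF T T']
  have col: "Q$1$3 = 0" "Q$2$3 = 0"
    using Q(8,9) t fc(1) by (simp_all add: eq_neg_iff_add_eq_0)
  have "(Q$3$3)\<^sup>2 = 1"
    using Q(2) col by (simp add: mat3_eq_iff matrix_matrix_mult_def sum_3 transpose_def power2_eq_square)
  moreover have "(Q$3$3)\<^sup>2 = 1 + (Q$3$1)\<^sup>2 + (Q$3$2)\<^sup>2"
    using Q(3) by (simp add: mat3_eq_iff matrix_matrix_mult_def sum_3 transpose_def power2_eq_square)
  ultimately have row: "Q$3$1 = 0" "Q$3$2 = 0" and Q33: "Q$3$3 * Q$3$3 = 1"
    by (auto simp: power2_eq_square add_nonneg_eq_0_iff)
  have cross: "a * (Q$1$1 * Q$2$1) + b * (Q$1$2 * Q$2$2) = 0"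
  proof (cases "t1 = t2")
    case True
    then have "t1' = t2'" "t1' \<noteq> - t3'" using fc t by auto
    then have "a = b" using prescribes_equal_coefficients[OF P] by blast
    moreover have "Q$1$1 * Q$2$1 + Q$1$2 * Q$2$2 = 0"
      using Q(3) col by (simp add: mat3_eq_iff matrix_matrix_mult_def sum_3 transpose_def)
    ultimately show ?thesis by (metis distrib_left mult_zero_right)
  next
    case False
    then have "Q$1$1 = 0 \<or> Q$2$1 = 0" "Q$1$2 = 0 \<or> Q$2$2 = 0" using Q(4-7) by auto
    then show ?thesis by auto
  qed
  have "g (A *v x) (A *v y) = diag_form (a * (Q$1$1)\<^sup>2 + b * (Q$1$2)\<^sup>2) (a * (Q$2$1)\<^sup>2 + b * (Q$2$2)\<^sup>2) d x y" for x y
  proof -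
    have inv: "A *v x = A' *v (lorentz_inverse Q *v x)" for x
      unfolding Q(1) by (metis lorentz_matrix_inverse(2)[OF Q(2)] matrix_vector_mul_assoc matrix_vector_mul_lid)
    have iQ: "lorentz_inverse Q = transpose Q"
      using col row by (simp add: mat3_eq_iff lorentz_inverse_def matrix_matrix_mult_def sum_3 transpose_def)
    have n: "(transpose Q *v x) $ 1 = Q$1$1 * x$1 + Q$2$1 * x$2"
      "(transpose Q *v x) $ 2 = Q$1$2 * x$1 + Q$2$2 * x$2" "(transpose Q *v x) $ 3 = Q$3$3 * x$3" for x
      using col row by (simp_all add: matrix_vector_mult_def sum_3 transpose_def del: transpose_matrix_vector)
    have "g (A *v x) (A *v y) = diag_form a b d (transpose Q *v x) (transpose Q *v y)"
      using g unfolding inv iQ diagonal_frame_def by blast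
    also have "\<dots> = diag_form (a * (Q$1$1)\<^sup>2 + b * (Q$1$2)\<^sup>2) (a * (Q$2$1)\<^sup>2 + b * (Q$2$2)\<^sup>2) (d * (Q$3$3 * Q$3$3)) x y
        + (a * (Q$1$1 * Q$2$1) + b * (Q$1$2 * Q$2$2)) * (x$1 * y$2 + x$2 * y$1)"
      unfolding diag_form_def n by (simp add: algebra_simps power2_eq_square)
    finally show ?thesis by (simp add: cross Q33)
  qed
  then have "diagonal_frame g A (a * (Q$1$1)\<^sup>2 + b * (Q$1$2)\<^sup>2) (a * (Q$2$1)\<^sup>2 + b * (Q$2$2)\<^sup>2) d"
    using T by (simp add: diagonal_frame_def)
  then show ?thesis by (rule that)
qed

section \<open>Uniqueness and infinitude of solutions\<close>

lemma solution_unique_up_to_scaling: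
  assumes T: "diagonal_frame T A t1 t2 t3" and cs: "cases_i_to_iv t1 t2 t3"
  shows "\<exists>s\<in>ricci_solutions T. \<forall>s'\<in>ricci_solutions T. (s, s') \<in> scaling_rel"
proof -
  obtain a b d c where P: "prescribes t1 t2 t3 a b d c" using prescribes_exists[OF cs] by blast
  have A: "lorentz_matrix A" using T by (simp add: diagonal_frame_def)
  define g where "g = frame_form A a b d"
  have "diagonal_frame g A a b d" using A by (simp add: g_def diagonal_frame_iff_frame_form)
  then have s: "(g, c) \<in> ricci_solutions T" using P ricci_solution_iff_prescribes[OF _ T] by blast
  have t: "t1 \<noteq> - t3" "t2 \<noteq> - t3" using cs by (auto simp: cases_i_to_iv_def)
  have "((g, c), (g', c')) \<in> scaling_rel" if s': "(g', c') \<in> ricci_solutions T" for g' c'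
  proof -
    obtain a' b' d' where g': "diagonal_frame g' A a' b' d'"
      using solution_diagonal_in_frame[OF T t s'] by blast
    then have "prescribes t1 t2 t3 a' b' d' c'" using s' ricci_solution_iff_prescribes[OF _ T] by blast
    then obtain k where k: "c' = c" "k > 0" "a' = k * a" "b' = k * b" "d' = k * d"
      using prescribes_unique[OF cs P] by blast
    have "g' = (\<lambda>x y. k * g x y)"
      using g' k by (simp add: diagonal_frame_iff_frame_form g_def frame_form_def diag_form_def fun_eq_iff algebra_simps)
    then show ?thesis using k by (auto simp: scaling_rel_def)
  qed
  then show ?thesis using s by (intro bexI[of _ "(g, c)"]) auto
qed

text \<open>On the walls \<open>d = a + b\<close>, \<open>b = a + d\<close> and \<open>a = b + d\<close> between the open cases the Ricci tensor
  is constant; this is the source of the nonuniqueness.\<close>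

lemma ricci1_degenerate:
  assumes "a > 0" "b > 0"
  shows "ricci1 a (a + b) b = - 8" "ricci1 a b (a + b) = - 8" "ricci1 (a + b) a b = 0"
proof -
  have nz: "(a + b) * b \<noteq> 0" using assms by simp
  have "ricci1 a (a + b) b = (- 8) * ((a + b) * b) / ((a + b) * b)"
    by (simp add: ricci1_def algebra_simps)
  also have "\<dots> = - 8" using nz by (rule nonzero_mult_div_cancel_right)
  finally show "ricci1 a (a + b) b = - 8" .
  then show "ricci1 a b (a + b) = - 8"
    by (simp add: ricci1_def algebra_simps)
  show "ricci1 (a + b) a b = 0" by (simp add: ricci1_def)
qed

lemma ricci3_degenerate:
  assumes "a > 0" "b > 0"
  shows "ricci3 a b (a + b) = 8" "ricci3 a (a + b) b = 0" "ricci3 (a + b) a b = 0"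
  using assms by (simp_all add: ricci3_def)

lemma prescribes_degenerate_constant:
  assumes P: "prescribes t1 t2 t3 a b d c" and cs: "cases_v_to_vii t1 t2 t3"
  shows "c * min t1 t2 = - 8"
proof -
  have pos: "a > 0" "b > 0" "d > 0" "c > 0"
    and r: "ricci1 a b d = c * t1" "ricci1 b a d = c * t2" "ricci3 a b d = c * t3"
    using P by (auto simp: prescribes_def)
  have zero: "ricci1 x y z = 0 \<longleftrightarrow> x = y + z" if "x > 0" "y > 0" "z > 0" for x y z
    using that by (auto simp: ricci1_def)
  consider "t1 = t2" "t2 = - t3" "t3 > 0" | "t1 < 0" "t2 = 0" "t3 = 0" | "t2 < 0" "t1 = 0" "t3 = 0"
    using cs by (auto simp: cases_v_to_vii_def)
  then show ?thesis
  proof cases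
    case 1
    have "(a - b - d) * (a + b - d) * (2 * (a + d) / (a * b * d)) = 0"
      using ricci_sums(1)[of a b d] pos r 1 by simp
    moreover have "a - b - d \<noteq> 0"
      using zero[of a b d] pos r 1 by auto
    ultimately have "d = a + b" using pos by auto
    then have "ricci3 a b d = 8" using pos by (simp add: ricci3_def)
    then show ?thesis using 1 r by simp
  next
    case 2
    then have "b = a + d" using zero[of b a d] pos r by simp
    then show ?thesis using ricci1_degenerate(1)[of a d] r pos 2 by simp
  next
    case 3
    then have "a = b + d" using zero[of a b d] pos r by simp
    then show ?thesis using ricci1_degenerate(1)[of b d] r pos 3 by simp
  qed
qed

text \<open>The minimum of \<open>t1\<close> and \<open>t2\<close> is a choice of the negative coefficient that does not depend on
  the frame, because in these cases a change of frame at most permutes the first two coefficients.\<close>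

lemma degenerate_constant_unique:
  assumes T: "diagonal_frame T A t1 t2 t3" and cs: "cases_v_to_vii t1 t2 t3"
    and s: "(g, c) \<in> ricci_solutions T"
  shows "c = - 8 / min t1 t2"
proof -
  obtain A' a b d t1' t2' t3' where "diagonal_frame g A' a b d"
    and T': "diagonal_frame T A' t1' t2' t3'" and P: "prescribes t1' t2' t3' a b d c"
    using ricci_solution_frame[OF s] by blast
  note fc = frame_coefficients[OF T T']
  have cs': "cases_v_to_vii t1' t2' t3'"
  proof (cases "t3 = 0")
    case True
    then show ?thesis
      using fc(1) prescribes_cases[OF P] cases_i_to_iv_admissible(2) by blast
  next
    case False
    then have "t1 = - t3" "t2 = - t3" "t3 > 0" using cs by (auto simp: cases_v_to_vii_def)
    then show ?thesis using fc by (auto simp: cases_v_to_vii_def)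
  qed
  have "min t1' t2' = min t1 t2"
    using fc cs cs' unfolding cases_v_to_vii_def by (smt (verit))
  then have "c * min t1 t2 = - 8" using prescribes_degenerate_constant[OF P cs'] by simp
  moreover have "min t1 t2 \<noteq> 0" using calculation by auto
  ultimately show ?thesis by (simp add: field_simps)
qed

text \<open>Each member lies on the wall that belongs to the case. One coefficient is kept equal to 1, so that
  no two members are proportional.\<close>

lemma degenerate_family:
  assumes cs: "cases_v_to_vii t1 t2 t3"
  shows "\<exists>p q r c. (\<forall>n::nat. prescribes t1 t2 t3 (p n) (q n) (r n) c) \<and>
    (\<forall>k m n. p m = k * p n \<and> q m = k * q n \<and> r m = k * r n \<longrightarrow> m = n)"
proof -
  consider "t1 = t2" "t2 = - t3" "t3 > 0" | "t1 < 0" "t2 = 0" "t3 = 0" | "t2 < 0" "t1 = 0" "t3 = 0"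
    using cs by (auto simp: cases_v_to_vii_def)
  then show ?thesis
  proof cases
    case 1
    have "prescribes t1 t2 t3 (real n + 1) 1 (real n + 1 + 1) (8 / t3)" for n
      using 1 ricci1_degenerate[of "real n + 1" 1] ricci1_degenerate(2)[of 1 "real n + 1"]
        ricci3_degenerate[of "real n + 1" 1] by (simp add: prescribes_def add.commute[of 1])
    then show ?thesis
      by (intro exI[of _ "\<lambda>n. real n + 1"] exI[of _ "\<lambda>_. 1"] exI[of _ "\<lambda>n. real n + 1 + 1"] exI conjI allI) auto
  next
    case 2
    have "prescribes t1 t2 t3 (real n + 1) (real n + 1 + 1) 1 (- 8 / t1)" for n
      using 2 ricci1_degenerate[of "real n + 1" 1] ricci1_degenerate(2)[of 1 "real n + 1"]
        ricci3_degenerate[of "real n + 1" 1] by (simp add: prescribes_def add.commute[of 1])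
    then show ?thesis
      by (intro exI[of _ "\<lambda>n. real n + 1"] exI[of _ "\<lambda>n. real n + 1 + 1"] exI[of _ "\<lambda>_. 1"] exI conjI allI) auto
  next
    case 3
    have "prescribes t1 t2 t3 (real n + 1 + 1) (real n + 1) 1 (- 8 / t2)" for n
      using 3 ricci1_degenerate[of "real n + 1" 1] ricci1_degenerate(2)[of 1 "real n + 1"]
        ricci3_degenerate[of "real n + 1" 1] by (simp add: prescribes_def add.commute[of 1])
    then show ?thesis
      by (intro exI[of _ "\<lambda>n. real n + 1 + 1"] exI[of _ "\<lambda>n. real n + 1"] exI[of _ "\<lambda>_. 1"] exI conjI allI) auto
  qed
qed

lemma degenerate_infinitely_many_solutions:
  assumes T: "diagonal_frame T A t1 t2 t3" and cs: "cases_v_to_vii t1 t2 t3"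
  shows "infinite (ricci_solutions T // scaling_rel)"
proof -
  obtain p q r :: "nat \<Rightarrow> real" and c :: real
    where P: "\<forall>n. prescribes t1 t2 t3 (p n) (q n) (r n) c"
    and inj: "\<forall>k m n. p m = k * p n \<and> q m = k * q n \<and> r m = k * r n \<longrightarrow> m = n"
    using degenerate_family[OF cs] by blast
  have A: "lorentz_matrix A" using T by (simp add: diagonal_frame_def)
  define s where "s = (\<lambda>n. (frame_form A (p n) (q n) (r n), c))"
  have "diagonal_frame (frame_form A (p n) (q n) (r n)) A (p n) (q n) (r n)" for n
    using A by (simp add: diagonal_frame_iff_frame_form)
  then have sol: "s n \<in> ricci_solutions T" for n
    using P ricci_solution_iff_prescribes[OF _ T] unfolding s_def by blast
  have "inj (\<lambda>n. scaling_rel `` {s n})"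
  proof (rule injI)
    fix n m assume "scaling_rel `` {s n} = scaling_rel `` {s m}"
    moreover have "(s m, s m) \<in> scaling_rel"
      by (auto simp: scaling_rel_def s_def intro!: exI[of _ 1])
    ultimately have "(s n, s m) \<in> scaling_rel" by blast
    then obtain k where e: "frame_form A (p m) (q m) (r m) = (\<lambda>x y. k * frame_form A (p n) (q n) (r n) x y)"
      by (auto simp: scaling_rel_def s_def)
    have "diag_form (p m) (q m) (r m) x y = diag_form (k * p n) (k * q n) (k * r n) x y" for x y
    proof -
      have "diag_form (p m) (q m) (r m) x y = k * diag_form (p n) (q n) (r n) x y"
        using fun_cong[OF fun_cong[OF e, of "A *v x"], of "A *v y"]
        by (simp add: frame_form_def lorentz_inverse_vector[OF A])
      then show ?thesis by (simp add: diag_form_def algebra_simps)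
    qed
    then show "n = m" using inj diag_form_eqD by metis
  qed
  then have "infinite (range (\<lambda>n. scaling_rel `` {s n}))" by (simp add: finite_image_iff)
  moreover have "range (\<lambda>n. scaling_rel `` {s n}) \<subseteq> ricci_solutions T // scaling_rel"
    using sol by (auto intro: quotientI)
  ultimately show ?thesis using infinite_super by blast
qed

theorem theorem5p1:
  fixes T :: "real ^ 3 \<Rightarrow> real ^ 3 \<Rightarrow> real"
  assumes "bilinear T"
  shows
    "((\<exists>g c. left_invariant_metric g \<and> c > 0 \<and> (\<forall>x y. Ric g x y = c * T x y)) \<longleftrightarrow>
      (\<exists>V T1 T2 T3. sl2_basis V \<and> diagonal_in T V T1 T2 T3 \<and>
         (cases_i_to_iv T1 T2 T3 \<or> cases_v_to_vii T1 T2 T3))) \<and>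
     (\<forall>V T1 T2 T3. sl2_basis V \<and> diagonal_in T V T1 T2 T3 \<and> cases_i_to_iv T1 T2 T3 \<longrightarrow>
        (\<exists>s\<in>ricci_solutions T. \<forall>s'\<in>ricci_solutions T. (s, s') \<in> scaling_rel)) \<and>
     (\<forall>V T1 T2 T3. sl2_basis V \<and> diagonal_in T V T1 T2 T3 \<and> cases_v_to_vii T1 T2 T3 \<longrightarrow>
        infinite (ricci_solutions T // scaling_rel) \<and>
        (\<exists>c0. \<forall>(g, c)\<in>ricci_solutions T. c = c0))"
proof -
  note frame = diagonal_frame_iff_diagonal_in[OF assms]
  have solvable: "(\<exists>g c. left_invariant_metric g \<and> c > 0 \<and> (\<forall>x y. Ric g x y = c * T x y)) \<longleftrightarrow>
      ricci_solutions T \<noteq> {}"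
    by (auto simp: ricci_solutions_def)
  have nec: "\<exists>V T1 T2 T3. sl2_basis V \<and> diagonal_in T V T1 T2 T3 \<and>
      (cases_i_to_iv T1 T2 T3 \<or> cases_v_to_vii T1 T2 T3)" if sol: "(g, c) \<in> ricci_solutions T" for g c
  proof -
    obtain A a b d t1 t2 t3 where "diagonal_frame g A a b d"
      and A: "diagonal_frame T A t1 t2 t3" and P: "prescribes t1 t2 t3 a b d c"
      using ricci_solution_frame[OF sol] by blast
    have "diagonal_frame T (frame_matrix (\<lambda>j. column j A)) t1 t2 t3"
      using A by (simp add: frame_matrix_columns)
    then show ?thesis using frame prescribes_cases[OF P] by blast
  qed
  have main: "\<exists>s\<in>ricci_solutions T. \<forall>s'\<in>ricci_solutions T. (s, s') \<in> scaling_rel"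
    if "sl2_basis V \<and> diagonal_in T V T1 T2 T3 \<and> cases_i_to_iv T1 T2 T3" for V T1 T2 T3
    using solution_unique_up_to_scaling[of T "frame_matrix V" T1 T2 T3] frame that by blast
  have degenerate: "infinite (ricci_solutions T // scaling_rel) \<and> (\<exists>c0. \<forall>(g, c)\<in>ricci_solutions T. c = c0)"
    if "sl2_basis V \<and> diagonal_in T V T1 T2 T3 \<and> cases_v_to_vii T1 T2 T3" for V T1 T2 T3
  proof -
    have T: "diagonal_frame T (frame_matrix V) T1 T2 T3" using frame that by blast
    show ?thesis
      using degenerate_infinitely_many_solutions[OF T] degenerate_constant_unique[OF T] that by blast
  qed
  have suff: "ricci_solutions T \<noteq> {}"
    if "sl2_basis V \<and> diagonal_in T V T1 T2 T3 \<and> (cases_i_to_iv T1 T2 T3 \<or> cases_v_to_vii T1 T2 T3)"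
    for V T1 T2 T3
    using main[of V T1 T2 T3] degenerate[of V T1 T2 T3] that by (metis empty_iff finite.emptyI quotient_empty)
  show ?thesis unfolding solvable using nec main degenerate suff by fast
qed

end
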